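(* Let $F:[0,1]\to[0,1]$, $F(x)=\lim_{n\to\infty}F_n(x)$, be the limit distribution function associated with odd continued fractions. If for some $x\in[0,1]$ the derivative $F'(x)$ exists (as a finite or infinite value), then either $F'(x)=0$ or $F'(x)=\infty$.
   Context: Odd continued fraction representation: every rational $x\in[0,1]$ is written uniquely as $$x=\left[1;\frac{\varepsilon_1}{a_1},\ldots,\frac{\varepsilon_l}{a_l}\right]=1+\cfrac{\varepsilon_1}{a_1+\cfrac{\varepsilon_2}{a_2+\cdots+\cfrac{\varepsilon_l}{a_l}}},$$ where all $a_i$ are odd positive integers, $\varepsilon_i\in\{1,-1\}$, $\varepsilon_1=-1$, and $a_j+\varepsilon_{j+1}\ge 2$ for $1\le j<l$; moreover, if the last partial quotient is $a_l=1$ with $l\ge 2$, then $\varepsilon_l=1$. (The number $x=1$ has $l=0$; the number $x=0$ is $\left[1;\frac{-1}{1}\right]$.) For rational $x\in[0,1]$ put $S(x)=\sum_{j=1}^{l}a_j$. For $n\ge1$ let $\mathcal{M}_n=\{x\in\mathbb{Q}\cap[0,1]: S(x)\le n+1\}$, which is a finite set, and $$F_n(x)=\frac{\#\{\xi\in\mathcal{M}_n:\xi\le x\}}{\#\mathcal{M}_n},\qquad x\in[0,1].$$ The limit $F(x)=\lim_{n\to\infty}F_n(x)$ exists for every $x\in[0,1]$. Derivatives are taken within $[0,1]$, so at the endpoints they are one-sided. *)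

theory Defs
  imports Complex_Main "HOL-Library.Extended_Real"
begin

text \<open>A finite odd continued fraction \<open>[1; \<epsilon>\<^sub>1/a\<^sub>1, \<dots>, \<epsilon>\<^sub>l/a\<^sub>l]\<close> is encoded by the list of
  pairs \<open>(\<epsilon>\<^sub>j, a\<^sub>j)\<close>; the list index is \<open>j - 1\<close>.\<close>

fun odd_cf_frac :: "(int \<times> nat) list \<Rightarrow> real" where
  "odd_cf_frac [] = 0"
| "odd_cf_frac ((e, a) # ps) = of_int e / (of_nat a + odd_cf_frac ps)"

definition odd_cf_value :: "(int \<times> nat) list \<Rightarrow> real" where
  "odd_cf_value ps = 1 + odd_cf_frac ps"

definition is_odd_cf :: "(int \<times> nat) list \<Rightarrow> bool" where
  "is_odd_cf ps \<longleftrightarrow>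
     (\<forall>(e, a) \<in> set ps. odd a \<and> e \<in> {1, -1}) \<and>
     (ps \<noteq> [] \<longrightarrow> fst (hd ps) = -1) \<and>
     (\<forall>j. Suc j < length ps \<longrightarrow> int (snd (ps ! j)) + fst (ps ! Suc j) \<ge> 2) \<and>
     (length ps \<ge> 2 \<and> snd (last ps) = 1 \<longrightarrow> fst (last ps) = 1)"

text \<open>Meaningful for rational \<open>x \<in> [0, 1]\<close>, where the expansion exists and is unique.\<close>

definition odd_cf :: "real \<Rightarrow> (int \<times> nat) list" where
  "odd_cf x = (THE ps. is_odd_cf ps \<and> odd_cf_value ps = x)"

definition odd_cf_sum :: "real \<Rightarrow> nat" where
  "odd_cf_sum x = sum_list (map snd (odd_cf x))"

definition odd_cf_M :: "nat \<Rightarrow> real set" where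
  "odd_cf_M n = {x \<in> \<rat> \<inter> {0..1}. odd_cf_sum x \<le> n + 1}"

definition odd_cf_Fn :: "nat \<Rightarrow> real \<Rightarrow> real" where
  "odd_cf_Fn n x = real (card {\<xi> \<in> odd_cf_M n. \<xi> \<le> x}) / real (card (odd_cf_M n))"

definition odd_cf_F :: "real \<Rightarrow> real" where
  "odd_cf_F x = lim (\<lambda>n. odd_cf_Fn n x)"

text \<open>\<open>D\<close> is the finite or infinite derivative of \<open>f\<close> at \<open>x\<close> within \<open>S\<close>; the limit of the
  difference quotients is taken in the extended reals. The two lemmas below relate the notion to
  the library's derivative and to divergence of the difference quotients.\<close>

definition has_ereal_derivative ::
    "(real \<Rightarrow> real) \<Rightarrow> ereal \<Rightarrow> real \<Rightarrow> real set \<Rightarrow> bool" where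
  "has_ereal_derivative f D x S \<longleftrightarrow>
     ((\<lambda>y. ereal ((f y - f x) / (y - x))) \<longlongrightarrow> D) (at x within S)"

lemma has_ereal_derivative_finite_iff:
  "has_ereal_derivative f (ereal d) x S \<longleftrightarrow> (f has_real_derivative d) (at x within S)"
  by (simp add: has_ereal_derivative_def has_field_derivative_iff)

lemma has_ereal_derivative_infinite_iff:
  "has_ereal_derivative f \<infinity> x S \<longleftrightarrow>
     filterlim (\<lambda>y. (f y - f x) / (y - x)) at_top (at x within S)"
  by (simp add: has_ereal_derivative_def tendsto_PInfty_eq_at_top)

end

theory Submission
  imports Defs
begin

text \<open>In the coordinate \<open>x = 1 - 1/z\<close>, removing the leading part of an odd continued fraction inverts
  one of the maps \<open>z \<mapsto> z + 2\<close>, \<open>z \<mapsto> 3 - 1/z\<close>, \<open>z \<mapsto> 1 + 1/z\<close>, which cost \<open>2\<close>, \<open>3\<close>, \<open>1\<close> in the digit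
  sum and, in terms of \<open>x\<close>, map \<open>[0,1]\<close> onto \<open>[2/3,1]\<close>, \<open>[1/2,2/3]\<close>, \<open>[0,1/2]\<close>. The counting function thus satisfies the
  tribonacci recurrence, and \<open>F\<close> gives an image of \<open>[0,1]\<close> of total cost \<open>k\<close> the mass \<open>\<tau>\<^sup>-\<^sup>k\<close>, where
  \<open>\<tau>\<^sup>3 = \<tau>\<^sup>2 + \<tau> + 1\<close>; its length is \<open>1/(r s)\<close> for the denominators \<open>r\<close>, \<open>s\<close> of its endpoints.
  If \<open>F'(x)\<close> is finite and nonzero, the mass quotients of nested cells around \<open>x\<close> agree asymptotically
  with their length quotients, which forces \<open>s/r \<longlongrightarrow> \<tau> - 1\<close>. But passing to the next cell turns
  \<open>t = s/r\<close> into \<open>2 + t\<close>, \<open>(1 + t)/(2 + t)\<close> or \<open>(1 + t)/t\<close>, and \<open>\<tau> - 1\<close> is fixed by none of these.\<close>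

subsection \<open>Expansions as words in three maps\<close>

text \<open>On a list with first sign -1 and value \<open>1 - 1/z\<close> this is the map z -> z +
  2.\<close>

fun raise_head :: "(int \<times> nat) list \<Rightarrow> (int \<times> nat) list" where
  "raise_head [] = []"
| "raise_head ((e, a) # ps) = (e, a + 2) # ps"

text \<open>Turns the fraction \<open>-1/z\<close> into \<open>1/z\<close>, so that prepending
  \<open>(-1, 1)\<close> afterwards gives z -> 1 + 1/z.\<close>

fun flip_head :: "(int \<times> nat) list \<Rightarrow> (int \<times> nat) list" where
  "flip_head [] = []"
| "flip_head ((e, a) # ps) = (- e, a) # ps"

text \<open>Rule \<open>three\<close> excludes the empty list because \<open>[(-1, 3)]\<close> already arises from \<open>[(-1, 1)]\<close> by
  \<open>two\<close>; with this the decomposition is unique.\<close>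

inductive odd_cf_tree :: "(int \<times> nat) list \<Rightarrow> bool" where
  root: "odd_cf_tree []"
| two: "odd_cf_tree ps \<Longrightarrow> ps \<noteq> [] \<Longrightarrow> odd_cf_tree (raise_head ps)"
| three: "odd_cf_tree ps \<Longrightarrow> ps \<noteq> [] \<Longrightarrow> ps \<noteq> [(-1, 1)] \<Longrightarrow> odd_cf_tree ((-1, 3) # ps)"
| one: "odd_cf_tree ps \<Longrightarrow> odd_cf_tree ((-1, 1) # flip_head ps)"

text \<open>The preceding partial quotient is carried along as \<open>a\<close>, which makes the
  condition on neighbours local to each cons. Since something precedes the tail, the proviso
  \<open>length ps \<ge> 2\<close> on a final 1 holds whenever the tail is nonempty.\<close>

fun odd_cf_tail :: "nat \<Rightarrow> (int \<times> nat) list \<Rightarrow> bool" where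
  "odd_cf_tail a [] \<longleftrightarrow> True"
| "odd_cf_tail a ((e, b) # ps) \<longleftrightarrow>
     odd b \<and> (e = 1 \<or> e = -1) \<and> int a + e \<ge> 2 \<and> (ps = [] \<and> b = 1 \<longrightarrow> e = 1) \<and> odd_cf_tail b ps"

text \<open>The sign \<open>d\<close> is a dummy: the condition on neighbours never looks at the
  sign of the first pair. In the induction it is instantiated to the sign \<open>e\<close> of the
  next pair.\<close>

lemma odd_cf_tail_iff:
  "odd_cf_tail a ps \<longleftrightarrow>
     (\<forall>(e, a) \<in> set ps. odd a \<and> e \<in> {1, -1}) \<and>
     (\<forall>j. Suc j < length ((d, a) # ps) \<longrightarrow>
        int (snd (((d, a) # ps) ! j)) + fst (((d, a) # ps) ! Suc j) \<ge> 2) \<and>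
     (ps \<noteq> [] \<and> snd (last ps) = 1 \<longrightarrow> fst (last ps) = 1)"
proof (induction a ps arbitrary: d rule: odd_cf_tail.induct)
  case (1 a)
  show ?case by simp
next
  case (2 a e b ps)
  have split: "(\<forall>j. Suc j < length ((d, a) # (e, b) # ps) \<longrightarrow>
        int (snd (((d, a) # (e, b) # ps) ! j)) + fst (((d, a) # (e, b) # ps) ! Suc j) \<ge> 2) \<longleftrightarrow>
      int a + e \<ge> 2 \<and> (\<forall>j. Suc j < length ((e, b) # ps) \<longrightarrow>
        int (snd (((e, b) # ps) ! j)) + fst (((e, b) # ps) ! Suc j) \<ge> 2)"
    (is "(\<forall>j. ?P j) \<longleftrightarrow> ?L \<and> (\<forall>j. ?Q j)")
  proof -
    have "(\<forall>j. ?P j) \<longleftrightarrow> ?P 0 \<and> (\<forall>j. ?P (Suc j))"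
      by (metis not0_implies_Suc)
    moreover have "?P 0 \<longleftrightarrow> ?L" by simp
    moreover have "?P (Suc j) \<longleftrightarrow> ?Q j" for j by simp
    ultimately show ?thesis by presburger
  qed
  show ?case
    unfolding split odd_cf_tail.simps 2[of e] by auto
qed

lemma is_odd_cf_Nil: "is_odd_cf []"
  by (simp add: is_odd_cf_def)

lemma is_odd_cf_Cons:
  "is_odd_cf ((e, a) # ps) \<longleftrightarrow> e = -1 \<and> odd a \<and> odd_cf_tail a ps"
  unfolding is_odd_cf_def odd_cf_tail_iff[of a ps e]
  by (cases ps) auto

lemma odd_cf_tail_raise: "odd_cf_tail a ps \<Longrightarrow> odd_cf_tail (a + 2) ps"
  by (cases ps) auto

lemma odd_cf_tree_head: "odd_cf_tree ps \<Longrightarrow> ps \<noteq> [] \<Longrightarrow> \<exists>a qs. ps = (-1, a) # qs"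
  by (induction rule: odd_cf_tree.induct) auto

text \<open>Raising the head only relaxes the bound on its neighbour; 3 tolerates a following -1,
  but \<open>[(-1, 1)]\<close> after it would end in 1 with sign -1; flipping gives the sign 1 that
  must follow a partial quotient 1.\<close>

lemma is_odd_cf_if_tree: "odd_cf_tree ps \<Longrightarrow> is_odd_cf ps"
proof (induction rule: odd_cf_tree.induct)
  case root
  show ?case by (rule is_odd_cf_Nil)
next
  case (two ps)
  obtain a qs where ps: "ps = (-1, a) # qs"
    using odd_cf_tree_head two by blast
  show ?case
    using two(3) odd_cf_tail_raise[of a qs] by (simp add: ps is_odd_cf_Cons)
next
  case (three ps)
  obtain a qs where ps: "ps = (-1, a) # qs"
    using odd_cf_tree_head three by blast
  show ?case
    using three by (auto simp: ps is_odd_cf_Cons)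
next
  case (one ps)
  show ?case
  proof (cases "ps = []")
    case True
    then show ?thesis by (simp add: is_odd_cf_Cons)
  next
    case False
    then obtain a qs where ps: "ps = (-1, a) # qs"
      using odd_cf_tree_head one by blast
    show ?thesis
      using one by (auto simp: ps is_odd_cf_Cons)
  qed
qed

text \<open>The head determines the last rule, and undoing that rule lowers the digit sum: a leading
  1 comes from \<open>one\<close>, a leading 3 followed by sign -1 from \<open>three\<close>,
  everything else from \<open>two\<close>.\<close>

lemma tree_if_is_odd_cf: "is_odd_cf ps \<Longrightarrow> odd_cf_tree ps"
proof (induction "sum_list (map snd ps)" arbitrary: ps rule: less_induct)
  case less
  show ?case
  proof (cases ps)
    case Nil
    then show ?thesis by (simp add: root)
  next
    case (Cons p rest)
    then obtain a where ps: "ps = (-1, a) # rest" and a: "odd a" and tail: "odd_cf_tail a rest"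
      using less.prems by (cases p) (auto simp: is_odd_cf_Cons)
    show ?thesis
    proof (cases "a = 1")
      case True
      show ?thesis
      proof (cases rest)
        case Nil
        then show ?thesis using one[OF root] True ps by simp
      next
        case (Cons q rs)
        obtain e b where q: "q = (e, b)" by fastforce
        have e: "e = 1" using tail True by (auto simp: Cons q)
        have "odd_cf_tree ((-1, b) # rs)"
          using tail True by (intro less.hyps) (auto simp: ps Cons q is_odd_cf_Cons)
        from one[OF this] show ?thesis by (simp add: ps True Cons q e)
      qed
    next
      case False
      with a obtain c where c: "a = c + 2" "odd c"
        by (metis One_nat_def add_2_eq_Suc' odd_Suc_minus_one even_Suc even_zero not0_implies_Suc)
      show ?thesis
      \<comment> \<open>Lowering the head by 2 fails only here, since a partial quotient 1 cannot
        precede the sign -1.\<close>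
      proof (cases "c = 1 \<and> rest \<noteq> [] \<and> fst (hd rest) = -1")
        case True
        then obtain b rs where rest: "rest = (-1, b) # rs"
          by (cases rest) auto
        have "odd_cf_tree rest"
          using tail by (intro less.hyps) (auto simp: ps c rest is_odd_cf_Cons)
        then have "odd_cf_tree ((-1, 3) # rest)"
          using tail by (intro three) (auto simp: rest)
        moreover have "a = 3" using True c by simp
        ultimately show ?thesis using ps by simp
      next
        case False
        have c3: "c \<noteq> 1 \<Longrightarrow> c \<ge> 3" using c(2) by presburger
        have "odd_cf_tail c rest"
        proof (cases rest)
          case (Cons q rs)
          obtain e b where "q = (e, b)" by fastforce
          then show ?thesis using Cons tail False c3 by (cases "c = 1") auto
        qed simp
        then have "odd_cf_tree ((-1, c) # rest)"
          using c by (intro less.hyps) (simp_all add: ps is_odd_cf_Cons)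
        from two[OF this] show ?thesis by (simp add: ps c)
      qed
    qed
  qed
qed

section \<open>The three maps acting on values; uniqueness and existence of expansions\<close>

definition branch_two :: "real \<Rightarrow> real" where "branch_two x = (2 - x) / (3 - 2 * x)"
definition branch_three :: "real \<Rightarrow> real" where "branch_three x = (1 + x) / (2 + x)"
definition branch_one :: "real \<Rightarrow> real" where "branch_one x = (1 - x) / (2 - x)"

lemmas branch_defs = branch_two_def branch_three_def branch_one_def

lemma odd_cf_frac_flip: "odd_cf_frac (flip_head ps) = - odd_cf_frac ps"
  by (cases ps rule: flip_head.cases) auto

lemma odd_cf_value_raise:
  assumes "odd_cf_tree ps" "odd_cf_value ps < 1"
  shows "odd_cf_value (raise_head ps) = branch_two (odd_cf_value ps)"
proof -
  have "ps \<noteq> []" using assms(2) by (auto simp: odd_cf_value_def)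
  then obtain a qs where ps: "ps = (-1, a) # qs"
    using odd_cf_tree_head assms(1) by blast
  define d where "d = a + odd_cf_frac qs"
  have val: "odd_cf_value ps = 1 - 1 / d" by (simp add: odd_cf_value_def ps d_def)
  \<comment> \<open>A value below 1 means \<open>1 / d > 0\<close>, which also excludes
    \<open>d = 0\<close>, where \<open>1 / d\<close> would be 0; no bound on the tail is
    required.\<close>
  then have d: "d > 0" using assms(2) by simp
  have "odd_cf_value (raise_head ps) = 1 - 1 / (d + 2)"
    by (simp add: odd_cf_value_def ps d_def algebra_simps)
  also have "\<dots> = branch_two (odd_cf_value ps)"
    unfolding val branch_two_def using d by (simp add: divide_simps)
  finally show ?thesis .
qed

lemma odd_cf_value_three:
  assumes "odd_cf_value ps \<ge> 0"
  shows "odd_cf_value ((-1, 3) # ps) = branch_three (odd_cf_value ps)"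
  using assms by (simp add: odd_cf_value_def branch_three_def divide_simps)

lemma odd_cf_value_one:
  assumes "odd_cf_value ps \<le> 1"
  shows "odd_cf_value ((-1, 1) # flip_head ps) = branch_one (odd_cf_value ps)"
  using assms by (simp add: odd_cf_value_def branch_one_def odd_cf_frac_flip divide_simps)

lemma branch_two_range: "0 \<le> x \<Longrightarrow> x < 1 \<Longrightarrow> 2/3 \<le> branch_two x \<and> branch_two x < 1"
  by (simp add: branch_two_def divide_simps)

lemma branch_three_range: "0 < x \<Longrightarrow> x < 1 \<Longrightarrow> 1/2 < branch_three x \<and> branch_three x < 2/3"
  by (simp add: branch_three_def divide_simps)

lemma branch_one_range: "0 \<le> x \<Longrightarrow> x \<le> 1 \<Longrightarrow> 0 \<le> branch_one x \<and> branch_one x \<le> 1/2"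
  by (simp add: branch_one_def divide_simps)

lemma branch_one_eq_0: "x \<le> 1 \<Longrightarrow> branch_one x = 0 \<longleftrightarrow> x = 1"
  by (simp add: branch_one_def)

lemma odd_cf_tree_value:
  "odd_cf_tree ps \<Longrightarrow> 0 \<le> odd_cf_value ps \<and> odd_cf_value ps \<le> 1 \<and>
     (odd_cf_value ps = 1 \<longleftrightarrow> ps = []) \<and> (odd_cf_value ps = 0 \<longleftrightarrow> ps = [(-1, 1)])"
proof (induction rule: odd_cf_tree.induct)
  case root
  then show ?case by (simp add: odd_cf_value_def)
next
  case (two ps)
  then have "odd_cf_value ps < 1" by auto
  with two odd_cf_value_raise[of ps] branch_two_range[of "odd_cf_value ps"] show ?case
    by (cases ps rule: raise_head.cases) auto
next
  case (three ps)
  have "0 < odd_cf_value ps" "odd_cf_value ps < 1" using three by (auto simp: less_le)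
  with odd_cf_value_three[of ps] branch_three_range[of "odd_cf_value ps"] show ?case
    by auto
next
  case (one ps)
  have "flip_head ps = [] \<longleftrightarrow> ps = []" by (cases ps rule: flip_head.cases) auto
  then show ?case
    using one odd_cf_value_one[of ps] branch_one_range[of "odd_cf_value ps"]
      branch_one_eq_0[of "odd_cf_value ps"] by auto
qed

lemma branch_two_inj: "x < 1 \<Longrightarrow> y < 1 \<Longrightarrow> branch_two x = branch_two y \<Longrightarrow> x = y"
  by (simp add: branch_two_def divide_simps) (simp add: algebra_simps)

lemma branch_three_inj: "0 < x \<Longrightarrow> 0 < y \<Longrightarrow> branch_three x = branch_three y \<Longrightarrow> x = y"
  by (simp add: branch_three_def divide_simps) (simp add: algebra_simps)

lemma branch_one_inj: "x \<le> 1 \<Longrightarrow> y \<le> 1 \<Longrightarrow> branch_one x = branch_one y \<Longrightarrow> x = y"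
  by (simp add: branch_one_def divide_simps) (simp add: algebra_simps)

text \<open>The four value ranges {1}, [2/3, 1), (1/2, 2/3), [0, 1/2] are disjoint, so the value
  alone reveals the last rule. Uniqueness follows by stripping rules with the injectivity of the
  branches.\<close>

lemma odd_cf_tree_cases:
  assumes "odd_cf_tree ps"
  obtains "ps = []" "odd_cf_value ps = 1"
  | qs where "ps = raise_head qs" "odd_cf_tree qs" "0 \<le> odd_cf_value qs" "odd_cf_value qs < 1"
      "odd_cf_value ps = branch_two (odd_cf_value qs)" "2/3 \<le> odd_cf_value ps" "odd_cf_value ps < 1"
  | qs where "ps = (-1, 3) # qs" "odd_cf_tree qs" "0 < odd_cf_value qs" "odd_cf_value qs < 1"
      "odd_cf_value ps = branch_three (odd_cf_value qs)" "1/2 < odd_cf_value ps" "odd_cf_value ps < 2/3"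
  | qs where "ps = (-1, 1) # flip_head qs" "odd_cf_tree qs" "0 \<le> odd_cf_value qs" "odd_cf_value qs \<le> 1"
      "odd_cf_value ps = branch_one (odd_cf_value qs)" "odd_cf_value ps \<le> 1/2"
  using assms
proof (cases rule: odd_cf_tree.cases)
  case root
  then show ?thesis using that(1) by (simp add: odd_cf_value_def)
next
  case (two qs)
  then have "0 \<le> odd_cf_value qs" "odd_cf_value qs < 1"
    using odd_cf_tree_value[of qs] by auto
  then show ?thesis
    using that(2)[of qs] two odd_cf_value_raise[of qs] branch_two_range[of "odd_cf_value qs"] by auto
next
  case (three qs)
  then have "0 < odd_cf_value qs" "odd_cf_value qs < 1"
    using odd_cf_tree_value[of qs] by (auto simp: less_le)
  then show ?thesis
    using that(3)[of qs] three odd_cf_value_three[of qs] branch_three_range[of "odd_cf_value qs"] by auto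
next
  case (one qs)
  then have "0 \<le> odd_cf_value qs" "odd_cf_value qs \<le> 1"
    using odd_cf_tree_value[of qs] by auto
  then show ?thesis
    using that(4)[of qs] one odd_cf_value_one[of qs] branch_one_range[of "odd_cf_value qs"] by auto
qed

lemma odd_cf_tree_unique:
  "odd_cf_tree ps \<Longrightarrow> odd_cf_tree qs \<Longrightarrow> odd_cf_value ps = odd_cf_value qs \<Longrightarrow> ps = qs"
proof (induction ps arbitrary: qs rule: odd_cf_tree.induct)
  case root
  have "odd_cf_value qs = 1" using root by (simp add: odd_cf_value_def)
  then show ?case using odd_cf_tree_value[OF root(1)] by simp
next
  case (two ps)
  have v: "0 \<le> odd_cf_value ps" "odd_cf_value ps < 1"
    using odd_cf_tree_value[of ps] two by auto
  note w = odd_cf_value_raise[OF two(1) v(2)] branch_two_range[OF v]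
  from \<open>odd_cf_tree qs\<close> show ?case
  proof (cases rule: odd_cf_tree_cases)
    case (2 rs)
    then have "ps = rs"
      using branch_two_inj[of "odd_cf_value ps" "odd_cf_value rs"] v w two by auto
    with 2 show ?thesis by simp
  qed (use w two in auto)
next
  case (three ps)
  have v: "0 < odd_cf_value ps" "odd_cf_value ps < 1"
    using odd_cf_tree_value[of ps] three by (auto simp: less_le)
  note w = odd_cf_value_three[of ps] branch_three_range[OF v]
  from \<open>odd_cf_tree qs\<close> show ?case
  proof (cases rule: odd_cf_tree_cases)
    case (3 rs)
    then have "ps = rs"
      using branch_three_inj[of "odd_cf_value ps" "odd_cf_value rs"] v w three by auto
    with 3 show ?thesis by simp
  qed (use v w three in auto)
next
  case (one ps)
  have v: "0 \<le> odd_cf_value ps" "odd_cf_value ps \<le> 1"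
    using odd_cf_tree_value[of ps] one by auto
  note w = odd_cf_value_one[of ps] branch_one_range[OF v]
  from \<open>odd_cf_tree qs\<close> show ?case
  proof (cases rule: odd_cf_tree_cases)
    case (4 rs)
    then have "ps = rs"
      using branch_one_inj[of "odd_cf_value ps" "odd_cf_value rs"] v w one by auto
    with 4 show ?thesis by simp
  qed (use v w one in auto)
qed

lemma odd_cf_sum_value:
  assumes "odd_cf_tree ps"
  shows "odd_cf_sum (odd_cf_value ps) = sum_list (map snd ps)"
proof -
  have "odd_cf (odd_cf_value ps) = ps"
    unfolding odd_cf_def
    using assms is_odd_cf_if_tree tree_if_is_odd_cf odd_cf_tree_unique
    by (intro the_equality) auto
  then show ?thesis by (simp add: odd_cf_sum_def)
qed

text \<open>A subtractive Euclidean algorithm: inverting the branch whose image contains p/q gives a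
  fraction with the smaller denominator q - p or 2p - q. Fractions need not be reduced.\<close>

lemma odd_cf_tree_exists_fraction:
  fixes p q :: nat
  assumes "p \<le> q" "0 < q"
  shows "\<exists>ps. odd_cf_tree ps \<and> odd_cf_value ps = real p / real q"
  using assms
proof (induction q arbitrary: p rule: less_induct)
  case (less q)
  consider "p = q" | "p = 0" | "0 < p" "2 * p \<le> q" | "q < 2 * p" "3 * p < 2 * q"
    | "2 * q \<le> 3 * p" "p < q"
    using less.prems by linarith
  then show ?case
  proof cases
    case 1
    have "odd_cf_value [] = real p / real q"
      using 1 less.prems by (simp add: odd_cf_value_def)
    then show ?thesis using root by blast
  next
    case 2
    have "odd_cf_value [(-1, 1)] = real p / real q"
      using 2 by (simp add: odd_cf_value_def)
    then show ?thesis using one[OF root] by auto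
  next
    case 3
    then have "q - p < q" "q - 2 * p \<le> q - p" "0 < q - p" by linarith+
    from less.IH[OF this] obtain ps
      where ps: "odd_cf_tree ps" "odd_cf_value ps = real (q - 2 * p) / real (q - p)" by blast
    have "branch_one (odd_cf_value ps) = real p / real q"
      unfolding ps branch_one_def using 3 by (simp add: of_nat_diff divide_simps)
    then show ?thesis
      using one[OF ps(1)] odd_cf_value_one[of ps] odd_cf_tree_value[OF ps(1)] by auto
  next
    case 4
    then have "q - p < q" "2 * p - q \<le> q - p" "0 < q - p" by linarith+
    from less.IH[OF this] obtain ps
      where ps: "odd_cf_tree ps" "odd_cf_value ps = real (2 * p - q) / real (q - p)" by blast
    have "branch_three (odd_cf_value ps) = real p / real q"
      unfolding ps branch_three_def using 4 by (simp add: of_nat_diff divide_simps)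
    moreover have "odd_cf_value ps > 0" "odd_cf_value ps < 1"
      unfolding ps using 4 by (auto simp: of_nat_diff divide_simps)
    ultimately show ?thesis
      using three[OF ps(1)] odd_cf_value_three[of ps] odd_cf_tree_value[OF ps(1)] by force
  next
    case 5
    then have "2 * p - q < q" "3 * p - 2 * q \<le> 2 * p - q" "0 < 2 * p - q" by linarith+
    from less.IH[OF this] obtain ps
      where ps: "odd_cf_tree ps" "odd_cf_value ps = real (3 * p - 2 * q) / real (2 * p - q)" by blast
    have "branch_two (odd_cf_value ps) = real p / real q"
      unfolding ps branch_two_def using 5 by (simp add: of_nat_diff divide_simps)
    moreover have "odd_cf_value ps < 1"
      unfolding ps using 5 by (auto simp: of_nat_diff divide_simps)
    ultimately show ?thesis
      using two[OF ps(1)] odd_cf_value_raise[of ps] odd_cf_tree_value[OF ps(1)] ps(1) by force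
  qed
qed

lemma odd_cf_tree_exists:
  assumes "x \<in> \<rat>" "0 \<le> x" "x \<le> 1"
  obtains ps where "odd_cf_tree ps" "odd_cf_value ps = x"
proof -
  from Rats_abs_nat_div_natE[OF assms(1)]
  obtain p q :: nat where "q \<noteq> 0" "\<bar>x\<bar> = real p / real q" by metis
  with assms have x: "x = real p / real q" and "0 < q" by auto
  then have "real p \<le> real q" using assms(3) by (simp add: divide_le_eq)
  then have "p \<le> q" by simp
  with x \<open>0 < q\<close> odd_cf_tree_exists_fraction[of p q] show ?thesis using that by metis
qed

section \<open>Digit sums under the three branches\<close>

lemma odd_cf_sum_1: "odd_cf_sum 1 = 0"
  using odd_cf_sum_value[OF root] by (simp add: odd_cf_value_def)

lemma odd_cf_sum_0: "odd_cf_sum 0 = 1"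
  using odd_cf_sum_value[OF one[OF root]] by (simp add: odd_cf_value_def)

lemma odd_cf_sum_branch_two:
  assumes "x \<in> \<rat>" "0 \<le> x" "x < 1"
  shows "odd_cf_sum (branch_two x) = odd_cf_sum x + 2"
proof -
  obtain ps where ps: "odd_cf_tree ps" "odd_cf_value ps = x"
    using odd_cf_tree_exists[of x] assms by auto
  have ne: "ps \<noteq> []" using ps assms odd_cf_tree_value by force
  have "sum_list (map snd (raise_head ps)) = sum_list (map snd ps) + 2"
    using ne by (cases ps rule: raise_head.cases) auto
  then show ?thesis
    using odd_cf_sum_value[OF two[OF ps(1) ne]] odd_cf_value_raise[OF ps(1)]
      odd_cf_sum_value[OF ps(1)] ps assms by simp
qed

text \<open>The point 0 has to be left out: \<open>branch_three 0\<close> is 1/2, whose digit sum is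
  2 and not 4.\<close>

lemma odd_cf_sum_branch_three:
  assumes "x \<in> \<rat>" "0 < x" "x < 1"
  shows "odd_cf_sum (branch_three x) = odd_cf_sum x + 3"
proof -
  obtain ps where ps: "odd_cf_tree ps" "odd_cf_value ps = x"
    using odd_cf_tree_exists[of x] assms by auto
  have ne: "ps \<noteq> []" "ps \<noteq> [(-1, 1)]" using ps assms odd_cf_tree_value by force+
  show ?thesis
    using odd_cf_sum_value[OF three[OF ps(1) ne]] odd_cf_value_three[of ps]
      odd_cf_sum_value[OF ps(1)] ps assms by simp
qed

lemma odd_cf_sum_branch_one:
  assumes "x \<in> \<rat>" "0 \<le> x" "x \<le> 1"
  shows "odd_cf_sum (branch_one x) = odd_cf_sum x + 1"
proof -
  obtain ps where ps: "odd_cf_tree ps" "odd_cf_value ps = x"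
    using odd_cf_tree_exists[of x] assms by auto
  have "sum_list (map snd (flip_head ps)) = sum_list (map snd ps)"
    by (cases ps rule: flip_head.cases) auto
  then show ?thesis
    using odd_cf_sum_value[OF one[OF ps(1)]] odd_cf_value_one[of ps]
      odd_cf_sum_value[OF ps(1)] ps assms by simp
qed

lemma odd_cf_sum_pos:
  assumes "x \<in> \<rat>" "0 \<le> x" "x < 1"
  shows "odd_cf_sum x > 0"
proof -
  obtain ps where ps: "odd_cf_tree ps" "odd_cf_value ps = x"
    using odd_cf_tree_exists[of x] assms by auto
  have "ps \<noteq> []" using ps assms odd_cf_tree_value by force
  with ps(1) have "sum_list (map snd ps) > 0"
  proof (induction rule: odd_cf_tree.induct)
    case (two ps)
    then show ?case by (cases ps rule: raise_head.cases) auto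
  qed auto
  then show ?thesis using odd_cf_sum_value ps by metis
qed

subsection \<open>Cells and counting\<close>

text \<open>Without 0 and 1, the images under the three branches are disjoint and miss only the cut
  points 1/2 and 2/3.\<close>

definition rat_points :: "nat \<Rightarrow> real set" where
  "rat_points m = {x \<in> \<rat>. 0 < x \<and> x < 1 \<and> odd_cf_sum x \<le> m}"

definition mobius :: "real \<Rightarrow> real \<Rightarrow> real \<Rightarrow> real \<Rightarrow> real \<Rightarrow> real" where
  "mobius p r q s x = (p * x + q * (1 - x)) / (r * x + s * (1 - x))"

text \<open>\<open>cell k p r q s\<close>: the composition of a word of branches of total cost \<open>k\<close> is \<open>mobius p r q s\<close>, which
  sends \<open>1\<close> to \<open>p/r\<close> and \<open>0\<close> to \<open>q/s\<close> (in either order).\<close>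

inductive cell :: "nat \<Rightarrow> real \<Rightarrow> real \<Rightarrow> real \<Rightarrow> real \<Rightarrow> bool" where
  unit: "cell 0 1 1 0 1"
| two: "cell k p r q s \<Longrightarrow> cell (k + 2) p r (2 * p + q) (2 * r + s)"
| three: "cell k p r q s \<Longrightarrow> cell (k + 3) (2 * p + q) (2 * r + s) (p + q) (r + s)"
| one: "cell k p r q s \<Longrightarrow> cell (k + 1) q s (p + q) (r + s)"

lemma cell_bounds:
  "cell k p r q s \<Longrightarrow> 1 \<le> r \<and> 1 \<le> s \<and> 0 \<le> p \<and> p \<le> r \<and> 0 \<le> q \<and> q \<le> s \<and>
     p \<in> \<rat> \<and> r \<in> \<rat> \<and> q \<in> \<rat> \<and> s \<in> \<rat>"
  by (induction rule: cell.induct) auto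

text \<open>Branches two and three keep the determinant, branch one negates it; its sign thus
  records the orientation of the cell.\<close>

lemma cell_det: "cell k p r q s \<Longrightarrow> p * s - q * r = 1 \<or> p * s - q * r = -1"
  by (induction rule: cell.induct) (auto simp: algebra_simps)

lemma mobius_denominator_pos:
  fixes r s x :: real
  assumes "1 \<le> r" "1 \<le> s" "0 \<le> x" "x \<le> 1"
  shows "0 < r * x + s * (1 - x)"
proof -
  show ?thesis
    using mult_right_mono[of 1 r x] mult_right_mono[of 1 s "1 - x"] assms by simp
qed

text \<open>A new branch is applied innermost, so the end fractions of the subcell are combinations
  of those of the cell. This is where the rules of \<open>cell\<close> come from.\<close>

lemma mobius_branch_two:
  assumes "x \<le> 1"
  shows "mobius p r q s (branch_two x) = mobius p r (2 * p + q) (2 * r + s) x"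
proof -
  define d where "d = 3 - 2 * x"
  have d: "d \<noteq> 0" using assms by (simp add: d_def)
  \<comment> \<open>One identity serves the numerator and, with r and s for p and q, the
    denominator; the common factor \<open>1 / d\<close> then cancels.\<close>
  have "p * ((2 - x) / d) + q * (1 - (2 - x) / d) = (p * x + (2 * p + q) * (1 - x)) / d" for p q
    using d by (simp add: field_simps) (simp add: d_def algebra_simps)
  then show ?thesis
    using d by (simp add: mobius_def branch_two_def flip: d_def)
qed

lemma mobius_branch_three:
  assumes "0 \<le> x"
  shows "mobius p r q s (branch_three x) = mobius (2 * p + q) (2 * r + s) (p + q) (r + s) x"
proof -
  define d where "d = 2 + x"
  have d: "d \<noteq> 0" using assms by (simp add: d_def)
  have "p * ((1 + x) / d) + q * (1 - (1 + x) / d) = ((2 * p + q) * x + (p + q) * (1 - x)) / d" for p q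
    using d by (simp add: field_simps) (simp add: d_def algebra_simps)
  then show ?thesis
    using d by (simp add: mobius_def branch_three_def flip: d_def)
qed

lemma mobius_branch_one:
  assumes "x \<le> 1"
  shows "mobius p r q s (branch_one x) = mobius q s (p + q) (r + s) x"
proof -
  define d where "d = 2 - x"
  have d: "d \<noteq> 0" using assms by (simp add: d_def)
  have "p * ((1 - x) / d) + q * (1 - (1 - x) / d) = (q * x + (p + q) * (1 - x)) / d" for p q
    using d by (simp add: field_simps) (simp add: d_def algebra_simps)
  then show ?thesis
    using d by (simp add: mobius_def branch_one_def flip: d_def)
qed

lemma branch_Rats:
  assumes "x \<in> \<rat>"
  shows "branch_two x \<in> \<rat>" "branch_three x \<in> \<rat>" "branch_one x \<in> \<rat>"
  using assms by (simp_all add: branch_defs)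

lemma cell_sum:
  "cell k p r q s \<Longrightarrow> x \<in> \<rat> \<Longrightarrow> 0 < x \<Longrightarrow> x < 1 \<Longrightarrow>
     odd_cf_sum (mobius p r q s x) = odd_cf_sum x + k"
proof (induction arbitrary: x rule: cell.induct)
  case unit
  show ?case by (simp add: mobius_def)
next
  case (two k p r q s)
  then show ?case
    using branch_two_range[of x] two.IH[of "branch_two x"] odd_cf_sum_branch_two[of x]
    by (simp add: branch_Rats flip: mobius_branch_two)
next
  case (three k p r q s)
  then show ?case
    using branch_three_range[of x] three.IH[of "branch_three x"] odd_cf_sum_branch_three[of x]
    by (simp add: branch_Rats flip: mobius_branch_three)
next
  case (one k p r q s)
  moreover have "0 < branch_one x" using one by (simp add: branch_one_def)
  ultimately show ?case
    using branch_one_range[of x] one.IH[of "branch_one x"] odd_cf_sum_branch_one[of x]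
    by (simp add: branch_Rats flip: mobius_branch_one)
qed

definition strictly_between :: "real \<Rightarrow> real \<Rightarrow> real set" where
  "strictly_between a b = {y. min a b < y \<and> y < max a b}"

definition cell_points :: "real \<Rightarrow> real \<Rightarrow> nat \<Rightarrow> real set" where
  "cell_points a b m = {y \<in> \<rat>. y \<in> strictly_between a b \<and> odd_cf_sum y \<le> m}"

text \<open>The differences of an image point to the two ends are the determinant \<open>e\<close>
  times positive quantities, so the point lies strictly between them for either sign of
  \<open>e\<close>.\<close>

lemma mobius_bij:
  assumes "1 \<le> r" "1 \<le> s" "p * s \<noteq> q * r"
  shows "bij_betw (mobius p r q s) {0<..<1} (strictly_between (p / r) (q / s))"
proof -
  define e where "e = p * s - q * r"
  have e: "e \<noteq> 0" using assms by (simp add: e_def)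
  have diff_q: "mobius p r q s x - q / s = e * x / (s * (r * x + s * (1 - x)))"
    and diff_p: "p / r - mobius p r q s x = e * (1 - x) / (r * (r * x + s * (1 - x)))"
    if "0 < x" "x < 1" for x
  proof -
    define D where "D = r * x + s * (1 - x)"
    have D: "D > 0" using mobius_denominator_pos[of r s x] that assms by (simp add: D_def)
    have "mobius p r q s x = (p * x + q * (1 - x)) / D" by (simp add: mobius_def D_def)
    then have "mobius p r q s x - q / s = ((p * x + q * (1 - x)) * s - q * D) / (s * D)"
      "p / r - mobius p r q s x = (p * D - (p * x + q * (1 - x)) * r) / (r * D)"
      using D assms by (simp_all only:) (simp_all add: diff_frac_eq mult.commute)
    then show "mobius p r q s x - q / s = e * x / (s * D)"
        "p / r - mobius p r q s x = e * (1 - x) / (r * D)"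
      by (simp_all add: D_def e_def algebra_simps)
  qed
  have dir: "mobius p r q s x \<in> strictly_between (p / r) (q / s)" if "0 < x" "x < 1" for x
  proof -
    define D where "D = r * x + s * (1 - x)"
    have D: "D > 0" using mobius_denominator_pos[of r s x] that assms by (simp add: D_def)
    have pos: "x / (s * D) > 0" "(1 - x) / (r * D) > 0" using D that assms by simp_all
    have eq: "mobius p r q s x - q / s = e * (x / (s * D))"
        "p / r - mobius p r q s x = e * ((1 - x) / (r * D))"
      using diff_q[OF that] diff_p[OF that] by (simp_all add: D_def)
    show ?thesis
    proof (cases "e > 0")
      case True
      then have "e * (x / (s * D)) > 0" "e * ((1 - x) / (r * D)) > 0"
        using pos by (simp_all only: mult_pos_pos)
      then show ?thesis unfolding strictly_between_def eq[symmetric] by auto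
    next
      case False
      with e have "e < 0" by simp
      then have "e * (x / (s * D)) < 0" "e * ((1 - x) / (r * D)) < 0"
        using pos by (simp_all only: mult_neg_pos)
      then show ?thesis unfolding strictly_between_def eq[symmetric] by auto
    qed
  qed
  \<comment> \<open>The inverse map: for the image y of x, \<open>y * s - q\<close> and
    \<open>p - y * r\<close> are proportional to x and 1 - x with the same factor.\<close>
  define g where "g y = (y * s - q) / (y * s - q + (p - y * r))" for y
  have g1: "g (mobius p r q s x) = x" if "0 < x" "x < 1" for x
  proof -
    define D where "D = r * x + s * (1 - x)"
    have D: "D > 0" using mobius_denominator_pos[of r s x] that assms by (simp add: D_def)
    have m: "mobius p r q s x = (p * x + q * (1 - x)) / D" by (simp add: mobius_def D_def)
    have "mobius p r q s x * s - q = e * x / D" "p - mobius p r q s x * r = e * (1 - x) / D"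
      unfolding m using D by (simp_all add: field_simps) (simp_all add: D_def e_def algebra_simps)
    then have "g (mobius p r q s x) = (e * x / D) / (e * x / D + e * (1 - x) / D)"
      by (simp add: g_def)
    also have "e * x / D + e * (1 - x) / D = e / D" by (simp add: algebra_simps flip: add_divide_distrib)
    finally show ?thesis using e D by simp
  qed
  have g2: "0 < g y \<and> g y < 1 \<and> mobius p r q s (g y) = y"
    if "y \<in> strictly_between (p / r) (q / s)" for y
  proof -
    define A where "A = y * s - q"
    define B where "B = p - y * r"
    have "A > 0 \<and> B > 0 \<or> A < 0 \<and> B < 0"
    proof (cases "p / r < q / s")
      case True
      then have "p / r < y" "y < q / s" using that by (auto simp: strictly_between_def)
      then show ?thesis using assms by (simp add: A_def B_def field_simps)
    next
      case False
      then have "q / s < y" "y < p / r" using that by (auto simp: strictly_between_def)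
      then show ?thesis using assms by (simp add: A_def B_def field_simps)
    qed
    then have AB: "A + B \<noteq> 0" "0 < A / (A + B)" "A / (A + B) < 1"
      by (auto simp: divide_simps)
    have gy: "g y = A / (A + B)" by (simp add: g_def A_def B_def)
    have og: "1 - g y = B / (A + B)" unfolding gy using AB(1) by (simp add: field_simps)
    have "mobius p r q s (g y) = ((p * A + q * B) / (A + B)) / ((r * A + s * B) / (A + B))"
      unfolding mobius_def og unfolding gy by (simp add: add_divide_distrib)
    also have "\<dots> = (p * A + q * B) / (r * A + s * B)" using AB(1) by simp
    also have "p * A + q * B = y * e" by (simp add: A_def B_def e_def algebra_simps)
    also have "r * A + s * B = e" by (simp add: A_def B_def e_def algebra_simps)
    finally show ?thesis using AB e by (simp add: gy)
  qed
  show ?thesis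
    by (rule bij_betw_byWitness[of _ g]) (use g1 g2 dir in auto)
qed

lemma mobius_Rats_iff:
  assumes "1 \<le> r" "1 \<le> s" "p * s \<noteq> q * r" "p \<in> \<rat>" "r \<in> \<rat>" "q \<in> \<rat>" "s \<in> \<rat>" "0 < x" "x < 1"
  shows "mobius p r q s x \<in> \<rat> \<longleftrightarrow> x \<in> \<rat>"
proof
  assume "x \<in> \<rat>"
  then show "mobius p r q s x \<in> \<rat>" using assms by (simp add: mobius_def)
next
  assume y: "mobius p r q s x \<in> \<rat>"
  define y where "y = mobius p r q s x"
  define D where "D = r * x + s * (1 - x)"
  have D: "D > 0" using mobius_denominator_pos[of r s x] assms by (simp add: D_def)
  have yD: "y * D = p * x + q * (1 - x)" using D by (simp add: y_def mobius_def flip: D_def)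
  then have x: "x * (y * s - q + (p - y * r)) = y * s - q"
    by (simp add: D_def algebra_simps)
  have "y * s - q + (p - y * r) \<noteq> 0"
  proof
    assume z: "y * s - q + (p - y * r) = 0"
    with x have "y * s = q" by simp
    with z have "p = y * r" by simp
    with \<open>y * s = q\<close> assms(3) show False by auto
  qed
  with x have "x = (y * s - q) / (y * s - q + (p - y * r))" by (simp add: field_simps)
  also have "\<dots> \<in> \<rat>" using assms y by (simp add: y_def)
  finally show "x \<in> \<rat>" .
qed

text \<open>Self-similarity of the count: all cells of cost \<open>k\<close> hold equally many
  points, because the composed map shifts every digit sum by \<open>k\<close>.\<close>

lemma cell_points_bij:
  assumes "cell k p r q s"
  shows "bij_betw (mobius p r q s) (rat_points m) (cell_points (p / r) (q / s) (m + k))"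
proof -
  note b = cell_bounds[OF assms]
  have det: "p * s \<noteq> q * r" using cell_det[OF assms] by auto
  have bij: "bij_betw (mobius p r q s) {0<..<1} (strictly_between (p / r) (q / s))"
    using mobius_bij b det by blast
  have "mobius p r q s ` rat_points m = cell_points (p / r) (q / s) (m + k)"
  proof (intro equalityI subsetI)
    fix y assume "y \<in> mobius p r q s ` rat_points m"
    then obtain x where x: "y = mobius p r q s x" "x \<in> \<rat>" "0 < x" "x < 1" "odd_cf_sum x \<le> m"
      by (auto simp: rat_points_def)
    with bij have "y \<in> strictly_between (p / r) (q / s)" by (auto simp: bij_betw_def)
    with x show "y \<in> cell_points (p / r) (q / s) (m + k)"
      using mobius_Rats_iff[of r s p q x] b det cell_sum[OF assms, of x]
      by (simp add: cell_points_def)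
  next
    fix y assume y: "y \<in> cell_points (p / r) (q / s) (m + k)"
    then have "y \<in> mobius p r q s ` {0<..<1}"
      using bij by (simp add: bij_betw_def cell_points_def)
    then obtain x where x: "y = mobius p r q s x" "0 < x" "x < 1" by auto
    with y show "y \<in> mobius p r q s ` rat_points m"
      using mobius_Rats_iff[of r s p q x] b det cell_sum[OF assms, of x]
      by (intro image_eqI[of _ _ x]) (auto simp: cell_points_def rat_points_def)
  qed
  moreover have "inj_on (mobius p r q s) (rat_points m)"
    using bij by (auto simp: bij_betw_def rat_points_def intro: inj_on_subset)
  ultimately show ?thesis by (simp add: bij_betw_def)
qed

section \<open>Finiteness and the tribonacci recurrence for the counts\<close>

lemma cell_level_one:
  "cell 2 1 1 2 3" "cell 3 2 3 1 2" "cell 1 0 1 1 2"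
  using cell.two[OF cell.unit] cell.three[OF cell.unit] cell.one[OF cell.unit]
  by (simp_all add: numeral_2_eq_2)

lemma rat_points_split:
  "rat_points m \<subseteq> cell_points 1 (2/3) m \<union> cell_points (2/3) (1/2) m \<union> cell_points 0 (1/2) m \<union> {1/2, 2/3}"
  by (auto simp: rat_points_def cell_points_def strictly_between_def)

lemma odd_cf_sum_half: "odd_cf_sum (1/2) = 2"
  using odd_cf_sum_branch_one[of 0] odd_cf_sum_0 by (simp add: branch_one_def)

lemma odd_cf_sum_two_thirds: "odd_cf_sum (2/3) = 3"
  using odd_cf_sum_branch_two[of 0] odd_cf_sum_0 by (simp add: branch_two_def)

text \<open>Each first-level cell has cost at least 1, so its points of digit sum at most
  \<open>Suc m\<close> lie in a copy of \<open>rat_points m\<close>, up to the two cut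
  points.\<close>

lemma finite_rat_points: "finite (rat_points m)"
proof (induction m)
  case 0
  have "rat_points 0 = {}" using odd_cf_sum_pos by (force simp: rat_points_def)
  then show ?case by simp
next
  case (Suc m)
  have "finite (cell_points (p / r) (q / s) (Suc m))" if "cell k p r q s" "k > 0" for k p r q s
  proof -
    have "finite (cell_points (p / r) (q / s) (m + k))"
      using cell_points_bij[OF that(1), of m] Suc bij_betw_finite by blast
    moreover have "cell_points (p / r) (q / s) (Suc m) \<subseteq> cell_points (p / r) (q / s) (m + k)"
      using that(2) by (auto simp: cell_points_def)
    ultimately show ?thesis by (rule rev_finite_subset)
  qed
  from this[OF cell_level_one(1)] this[OF cell_level_one(2)] this[OF cell_level_one(3)]
  show ?case
    by (intro finite_subset[OF rat_points_split]) auto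
qed

lemma finite_cell_points: "cell k p r q s \<Longrightarrow> finite (cell_points (p / r) (q / s) (m + k))"
  using cell_points_bij[of k p r q s m] finite_rat_points bij_betw_finite by blast

lemma card_cell_points: "cell k p r q s \<Longrightarrow> card (cell_points (p / r) (q / s) (m + k)) = card (rat_points m)"
  using cell_points_bij[of k p r q s m] bij_betw_same_card by fastforce

text \<open>The counts satisfy the tribonacci recurrence with an extra 2 for the cut points 1/2 and
  2/3; adding 1 to every count absorbs it.\<close>

definition trib :: "nat \<Rightarrow> nat" where "trib m = card (rat_points m) + 1"

lemma trib_pos: "0 < trib m"
  by (simp add: trib_def)

lemma trib_rec: "trib (m + 3) = trib (m + 2) + trib (m + 1) + trib m"
proof -
  let ?A = "cell_points 1 (2/3) (m + 3)" and ?B = "cell_points (2/3) (1/2) (m + 3)"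
    and ?C = "cell_points 0 (1/2) (m + 3)"
  have fin: "finite ?A" "finite ?B" "finite ?C"
    using finite_cell_points[OF cell_level_one(1), of "m + 1"]
      finite_cell_points[OF cell_level_one(2), of m]
      finite_cell_points[OF cell_level_one(3), of "m + 2"]
    by (simp_all add: numeral_3_eq_3)
  have card: "card ?A = card (rat_points (m + 1))" "card ?B = card (rat_points m)"
      "card ?C = card (rat_points (m + 2))"
    using card_cell_points[OF cell_level_one(1), of "m + 1"]
      card_cell_points[OF cell_level_one(2), of m]
      card_cell_points[OF cell_level_one(3), of "m + 2"]
    by (simp_all add: numeral_3_eq_3)
  \<comment> \<open>Both cut points belong to the set because their digit sums, 2 and 3, are at most
    m + 3.\<close>
  have "rat_points (m + 3) = ?A \<union> (?B \<union> (?C \<union> {1/2, 2/3}))"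
    using odd_cf_sum_half odd_cf_sum_two_thirds
    by (auto simp: rat_points_def cell_points_def strictly_between_def)
  moreover have "?A \<inter> (?B \<union> (?C \<union> {1/2, 2/3})) = {}" "?B \<inter> (?C \<union> {1/2, 2/3}) = {}"
      "?C \<inter> {1/2, 2/3} = {}"
    by (auto simp: cell_points_def strictly_between_def)
  ultimately have "card (rat_points (m + 3)) = card ?A + (card ?B + (card ?C + 2))"
    using fin by (simp add: card_Un_disjoint)
  then show ?thesis unfolding card by (simp add: trib_def)
qed

section \<open>The tribonacci constant and the growth of the counts\<close>

definition tau :: real where "tau = (SOME l. 1 < l \<and> l ^ 3 = l ^ 2 + l + 1)"

lemma tau: "1 < tau" "tau ^ 3 = tau ^ 2 + tau + 1"
proof -
  have "\<exists>l::real. 1 \<le> l \<and> l \<le> 2 \<and> l ^ 3 - l ^ 2 - l - 1 = 0"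
    by (rule IVT') (auto intro!: continuous_intros)
  then obtain l :: real where l: "1 \<le> l" "l ^ 3 - l ^ 2 - l - 1 = 0" by blast
  then have "l \<noteq> 1" by auto
  with l have "1 < l \<and> l ^ 3 = l ^ 2 + l + 1" by simp
  from someI[of "\<lambda>l. 1 < l \<and> l ^ 3 = l ^ 2 + l + 1", OF this]
  show "1 < tau" "tau ^ 3 = tau ^ 2 + tau + 1" by (simp_all add: tau_def)
qed

text \<open>Writing \<open>1 = p\<^sub>1 + p\<^sub>2 + p\<^sub>3\<close> with \<open>p\<^sub>i = l\<^sup>-\<^sup>i\<close>, the normalised sequence is a moving average of
  its last three values, so its differences obey a contracting two-term recurrence.\<close>

lemma tribonacci_asymptotics:
  fixes u :: "nat \<Rightarrow> real"
  assumes l: "1 < l" "l ^ 3 = l ^ 2 + l + 1"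
    and rec: "\<And>m. u (m + 3) = u (m + 2) + u (m + 1) + u m"
    and pos: "\<And>m. u m > 0"
  obtains L where "L > 0" "(\<lambda>m. u m / l ^ m) \<longlonglongrightarrow> L"
proof -
  define p1 p2 p3 where p: "p1 = 1 / l" "p2 = 1 / l ^ 2" "p3 = 1 / l ^ 3"
  have p_pos: "p1 > 0" "p2 > 0" "p3 > 0" using l(1) by (simp_all add: p)
  have p_sum: "p1 + p2 + p3 = 1"
  proof -
    have "p1 + p2 + p3 = (l ^ 2 + l + 1) / l ^ 3"
      using l(1) by (simp add: p field_simps power2_eq_square power3_eq_cube)
    also have "\<dots> = l ^ 3 / l ^ 3" by (simp only: l(2))
    also have "\<dots> = 1" using l(1) by (intro divide_self) simp
    finally show ?thesis .
  qed
  have "l < l ^ 3" using power_strict_increasing[of 1 3 l] l(1) by simp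
  then have p31: "p3 < p1" using l(1) by (simp add: p frac_less2)
  define v where "v m = u m / l ^ m" for m
  have v_rec: "v (m + 3) = p1 * v (m + 2) + p2 * v (m + 1) + p3 * v m" for m
    using l(1) by (simp add: v_def rec p field_simps power_add power2_eq_square power3_eq_cube)
  define d where "d m = v (Suc m) - v m" for m
  \<comment> \<open>The weights of the recurrence for \<open>d\<close> have absolute values p2 + p3
    and p3, with total p2 + 2 p3 < p1 + p2 + p3 = 1. Two steps contract by this total, so one step
    contracts by its square root.\<close>
  define q where "q = p2 + 2 * p3"
  have q: "0 < q" "q < 1" using p_pos p_sum p31 by (simp_all add: q_def)
  define \<rho> where "\<rho> = sqrt q"
  have \<rho>: "0 < \<rho>" "\<rho> < 1" "\<rho> ^ 2 = q" using q by (simp_all add: \<rho>_def)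
  have d_rec: "d (m + 2) = - (p2 + p3) * d (m + 1) - p3 * d m" for m
  proof -
    have "d (m + 2) = v (m + 3) - v (m + 2)" by (simp add: d_def numeral_3_eq_3)
    also have "\<dots> = (p1 - 1) * v (m + 2) + p2 * v (m + 1) + p3 * v m"
      by (simp add: v_rec algebra_simps)
    also have "p1 - 1 = - (p2 + p3)" using p_sum by simp
    finally show ?thesis by (simp add: d_def algebra_simps)
  qed
  define C where "C = max \<bar>d 0\<bar> (\<bar>d 1\<bar> / \<rho>)"
  have d_bound: "\<bar>d m\<bar> \<le> C * \<rho> ^ m \<and> \<bar>d (m + 1)\<bar> \<le> C * \<rho> ^ (m + 1)" for m
  proof (induction m)
    case 0
    have "\<bar>d 1\<bar> = \<bar>d 1\<bar> / \<rho> * \<rho>" using \<rho> by simp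
    also have "\<dots> \<le> C * \<rho>" using \<rho> by (intro mult_right_mono) (simp_all add: C_def)
    finally show ?case by (simp add: C_def)
  next
    case (Suc m)
    have C: "0 \<le> C * \<rho> ^ m" using \<rho> by (simp add: C_def le_max_iff_disj)
    have "\<bar>d (m + 2)\<bar> \<le> (p2 + p3) * \<bar>d (m + 1)\<bar> + p3 * \<bar>d m\<bar>"
      unfolding d_rec using p_pos abs_triangle_ineq4[of "- (p2 + p3) * d (m + 1)" "p3 * d m"]
      by (simp add: abs_mult add.commute)
    also have "\<dots> \<le> (p2 + p3) * (C * \<rho> ^ m) + p3 * (C * \<rho> ^ m)"
    proof (intro add_mono mult_left_mono)
      have "C * \<rho> ^ (m + 1) \<le> C * \<rho> ^ m" 
        using mult_left_le_one_le[OF C, of \<rho>] \<rho> by (simp add: mult.left_commute)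
      then show "\<bar>d (m + 1)\<bar> \<le> C * \<rho> ^ m" using Suc by linarith
    qed (use Suc p_pos in auto)
    also have "\<dots> = C * \<rho> ^ m * \<rho> ^ 2" unfolding \<rho>(3) q_def by (simp add: algebra_simps)
    also have "\<dots> = C * \<rho> ^ (m + 2)" by (simp add: power_add power2_eq_square)
    finally show ?case using Suc by simp
  qed
  have "summable (\<lambda>m. C * \<rho> ^ m)" using \<rho> by (intro summable_mult summable_geometric) simp
  then have "summable d"
    by (rule summable_comparison_test') (use d_bound in \<open>simp add: real_norm_def\<close>)
  then have "(\<lambda>n. \<Sum>i<n. d i) \<longlonglongrightarrow> suminf d" by (rule summable_LIMSEQ)
  moreover have "(\<Sum>i<n. d i) = v n - v 0" for n
    unfolding d_def by (rule sum_lessThan_telescope)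
  ultimately have "(\<lambda>n. v n - v 0 + v 0) \<longlonglongrightarrow> suminf d + v 0"
    by (intro tendsto_intros) simp
  then have lim: "v \<longlonglongrightarrow> suminf d + v 0" by simp
  \<comment> \<open>A moving average never falls below the minimum of its three starting values,
    which keeps the limit positive.\<close>
  define c where "c = min (v 0) (min (v 1) (v 2))"
  have c: "c > 0" using pos l by (simp add: c_def v_def)
  have "v m \<ge> c \<and> v (m + 1) \<ge> c \<and> v (m + 2) \<ge> c" for m
  proof (induction m)
    case 0
    show ?case by (simp add: c_def min_le_iff_disj numeral_2_eq_2)
  next
    case (Suc m)
    have "c = p1 * c + p2 * c + p3 * c" using p_sum by (metis distrib_right mult_1)
    also have "\<dots> \<le> p1 * v (m + 2) + p2 * v (m + 1) + p3 * v m"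
      using Suc p_pos by (intro add_mono mult_left_mono) auto
    finally have "c \<le> v (m + 3)" by (simp add: v_rec)
    then show ?case using Suc by (simp add: numeral_3_eq_3)
  qed
  then have "suminf d + v 0 \<ge> c" using lim by (intro LIMSEQ_le_const) auto
  with c have "suminf d + v 0 > 0" by linarith
  with lim show ?thesis by (intro that) (simp_all add: v_def[abs_def])
qed

text \<open>The quotient is the share of \<open>odd_cf_M (n + k)\<close> lying inside a cell of cost
  \<open>k\<close>; the terms -1 and +1 vanish after division by powers of
  \<open>tau\<close>.\<close>

lemma rat_points_ratio:
  "(\<lambda>n. (real (trib (n + 1)) - 1) / (real (trib (n + k + 1)) + 1)) \<longlonglongrightarrow> (1 / tau) ^ k"
proof -
  obtain L where L: "L > 0" "(\<lambda>m. real (trib m) / tau ^ m) \<longlonglongrightarrow> L"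
    using tribonacci_asymptotics[OF tau, of "\<lambda>m. real (trib m)"]
    by (metis of_nat_0_less_iff of_nat_add trib_rec trib_pos)
  have inv: "(\<lambda>m. 1 / tau ^ m) \<longlonglongrightarrow> 0"
    using LIMSEQ_realpow_zero[of "1 / tau"] tau(1) by (simp add: power_one_over)
  have "(\<lambda>m. real (trib m) / tau ^ m - 1 / tau ^ m) \<longlonglongrightarrow> L - 0"
    by (intro tendsto_intros L inv)
  then have a: "(\<lambda>n. real (trib (n + 1)) / tau ^ (n + 1) - 1 / tau ^ (n + 1)) \<longlonglongrightarrow> L"
    using LIMSEQ_ignore_initial_segment by fastforce
  have "(\<lambda>m. real (trib m) / tau ^ m + 1 / tau ^ m) \<longlonglongrightarrow> L + 0"
    by (intro tendsto_intros L inv)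
  then have b: "(\<lambda>n. real (trib (n + (k + 1))) / tau ^ (n + (k + 1)) + 1 / tau ^ (n + (k + 1))) \<longlonglongrightarrow> L"
    using LIMSEQ_ignore_initial_segment by fastforce
  from tendsto_mult[OF tendsto_divide[OF a b] tendsto_const[of "(1 / tau) ^ k"]] L
  have "(\<lambda>n. (real (trib (n + 1)) / tau ^ (n + 1) - 1 / tau ^ (n + 1)) /
      (real (trib (n + (k + 1))) / tau ^ (n + (k + 1)) + 1 / tau ^ (n + (k + 1))) * (1 / tau) ^ k)
      \<longlonglongrightarrow> (1 / tau) ^ k" by simp
  moreover have "(x / tau ^ (n + 1) - 1 / tau ^ (n + 1)) /
      (y / tau ^ (n + (k + 1)) + 1 / tau ^ (n + (k + 1))) * (1 / tau) ^ k = (x - 1) / (y + 1)" for x y n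
  proof -
    have "(x / P - 1 / P) / (y / (P * K) + 1 / (P * K)) * (1 / K) = (x - 1) / (y + 1)"
      if "P \<noteq> 0" "K \<noteq> 0" for P K :: real
    proof -
      have "(x / P - 1 / P) / (y / (P * K) + 1 / (P * K)) = ((x - 1) / P) / ((y + 1) / (P * K))"
        by (simp add: diff_divide_distrib add_divide_distrib)
      then show ?thesis using that by simp
    qed
    from this[of "tau ^ (n + 1)" "tau ^ k"] show ?thesis
      using tau(1) by (simp add: power_add power_one_over mult.assoc)
  qed
  ultimately show ?thesis by (simp add: add.assoc)
qed

subsection \<open>The distribution function on cells\<close>

lemma odd_cf_M_eq: "odd_cf_M n = {0, 1} \<union> rat_points (n + 1)"
  using odd_cf_sum_0 odd_cf_sum_1 by (auto simp: odd_cf_M_def rat_points_def)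

lemma finite_odd_cf_M: "finite (odd_cf_M n)"
  by (simp add: odd_cf_M_eq finite_rat_points)

lemma card_odd_cf_M: "card (odd_cf_M n) = trib (n + 1) + 1"
proof -
  have "{0, 1} \<inter> rat_points (n + 1) = {}" by (auto simp: rat_points_def)
  then show ?thesis
    unfolding odd_cf_M_eq by (subst card_Un_disjoint) (simp_all add: finite_rat_points trib_def)
qed

text \<open>The half-open interval counted on the left differs from the open one only by the point
  \<open>b\<close>.\<close>

lemma odd_cf_Fn_diff:
  assumes "0 \<le> a" "a < b" "b \<le> 1"
  shows "\<bar>odd_cf_Fn n b - odd_cf_Fn n a - real (card (cell_points a b (n + 1))) / real (card (odd_cf_M n))\<bar>
     \<le> 1 / real (card (odd_cf_M n))"
proof -
  let ?A = "{\<xi> \<in> odd_cf_M n. \<xi> \<le> a}" and ?B = "{\<xi> \<in> odd_cf_M n. \<xi> \<le> b}"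
  let ?C = "cell_points a b (n + 1)" and ?E = "odd_cf_M n \<inter> {b}"
  have "?B = (?A \<union> ?C) \<union> ?E"
    using assms by (auto simp: odd_cf_M_def cell_points_def strictly_between_def)
  moreover have "?A \<inter> ?C = {}" "(?A \<union> ?C) \<inter> ?E = {}"
    using assms by (auto simp: cell_points_def strictly_between_def)
  moreover have fin: "finite ?A" "finite ?B" using finite_odd_cf_M by simp_all
  moreover have "finite ?C"
    using assms by (intro finite_subset[OF _ fin(2)])
      (auto simp: odd_cf_M_def cell_points_def strictly_between_def)
  ultimately have "card ?B = card ?A + card ?C + card ?E"
    by (simp add: card_Un_disjoint)
  moreover have "card ?E \<le> 1" using card_mono[of "{b}" ?E] by simp
  ultimately have "\<bar>real (card ?B) - real (card ?A) - real (card ?C)\<bar> \<le> 1" by simp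
  then have "\<bar>real (card ?B) - real (card ?A) - real (card ?C)\<bar> / real (card (odd_cf_M n))
      \<le> 1 / real (card (odd_cf_M n))" by (rule divide_right_mono) simp
  then show ?thesis
    unfolding odd_cf_Fn_def diff_divide_distrib[symmetric] abs_divide by simp
qed

lemma inverse_card_tendsto: "(\<lambda>n. 1 / real (card (odd_cf_M n))) \<longlonglongrightarrow> 0"
proof -
  have t: "trib (m + 3) \<ge> m" for m
  proof (induction m)
    case (Suc m)
    have "trib (Suc m + 3) \<ge> trib (m + 3) + trib (Suc m)"
      using trib_rec[of "Suc m"] by (simp add: numeral_3_eq_3)
    then show ?case using Suc trib_pos[of "Suc m"] by linarith
  qed simp
  have "filterlim (\<lambda>n. real (card (odd_cf_M (n + 2)))) at_top sequentially"
  proof (rule filterlim_at_top_mono[OF filterlim_real_sequentially])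
    have "n \<le> card (odd_cf_M (n + 2))" for n
      using t[of n] by (simp add: card_odd_cf_M numeral_3_eq_3)
    then show "\<forall>\<^sub>F n in sequentially. real n \<le> real (card (odd_cf_M (n + 2)))" by simp
  qed
  then have "(\<lambda>n. 1 / real (card (odd_cf_M (n + 2)))) \<longlonglongrightarrow> 0"
    by (intro tendsto_divide_0[OF tendsto_const] filterlim_at_top_imp_at_infinity)
  then show ?thesis by (rule LIMSEQ_offset)
qed

lemma cell_points_commute: "cell_points a b = cell_points b a"
  by (simp add: fun_eq_iff cell_points_def strictly_between_def min.commute max.commute)

lemma cell_points_density:
  assumes "cell k p r q s"
  shows "(\<lambda>n. real (card (cell_points (p / r) (q / s) (n + 1))) / real (card (odd_cf_M n)))
     \<longlonglongrightarrow> (1 / tau) ^ k"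
proof (rule LIMSEQ_offset[of _ k])
  have card: "card (cell_points (p / r) (q / s) (n + k + 1)) = trib (n + 1) - 1" for n
    using card_cell_points[OF assms, of "n + 1"] by (simp add: trib_def)
  then have "real (card (cell_points (p / r) (q / s) (n + k + 1))) / real (card (odd_cf_M (n + k)))
      = (real (trib (n + 1)) - 1) / (real (trib (n + k + 1)) + 1)" for n
    using trib_pos[of "n + 1"] unfolding card by (simp add: card_odd_cf_M of_nat_diff)
  then show "(\<lambda>n. real (card (cell_points (p / r) (q / s) (n + k + 1))) / real (card (odd_cf_M (n + k))))
      \<longlonglongrightarrow> (1 / tau) ^ k"
    using rat_points_ratio[of k] by simp
qed

lemma cell_endpoints:
  assumes "cell k p r q s"
  shows "p / r \<in> {0..1}" "q / s \<in> {0..1}" "p / r - q / s = (p * s - q * r) / (r * s)"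
  using cell_bounds[OF assms] by (auto simp: divide_simps)

lemma odd_cf_Fn_increment:
  assumes "cell k p r q s"
  shows "(\<lambda>n. odd_cf_Fn n (p / r) - odd_cf_Fn n (q / s)) \<longlonglongrightarrow> (p * s - q * r) * (1 / tau) ^ k"
proof -
  have lim: "(\<lambda>n. odd_cf_Fn n b - odd_cf_Fn n a) \<longlonglongrightarrow> (1 / tau) ^ k"
    if "0 \<le> a" "a < b" "b \<le> 1"
      and dens: "(\<lambda>n. real (card (cell_points a b (n + 1))) / real (card (odd_cf_M n))) \<longlonglongrightarrow> (1 / tau) ^ k"
    for a b
  proof -
    let ?d = "\<lambda>n. odd_cf_Fn n b - odd_cf_Fn n a - real (card (cell_points a b (n + 1))) / real (card (odd_cf_M n))"
    have "?d \<longlonglongrightarrow> 0"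
      by (rule tendsto_0_le[OF inverse_card_tendsto, of _ 1])
        (use odd_cf_Fn_diff[OF that(1-3)] in simp)
    from tendsto_add[OF this dens] show ?thesis by simp
  qed
  note b = cell_bounds[OF assms] and e = cell_endpoints[OF assms]
  have rs: "r * s > 0" using b by simp
  show ?thesis
  proof (cases "p * s - q * r = 1")
    case True
    then have "p / r - q / s > 0" using e(3) rs by simp
    with lim[of "q / s" "p / r"] e cell_points_density[OF assms] True show ?thesis
      by (simp add: cell_points_commute)
  next
    case False
    then have m: "p * s - q * r = -1" using cell_det[OF assms] by simp
    then have "p / r - q / s < 0" using e(3) rs by simp
    with lim[of "p / r" "q / s"] e cell_points_density[OF assms]
    have "(\<lambda>n. odd_cf_Fn n (q / s) - odd_cf_Fn n (p / r)) \<longlonglongrightarrow> (1 / tau) ^ k" by simp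
    from tendsto_minus[OF this] show ?thesis unfolding m by simp
  qed
qed

lemma convergent_from_increment:
  assumes "(\<lambda>n. f n - g n :: real) \<longlonglongrightarrow> c"
  shows "convergent f \<longleftrightarrow> convergent g"
proof
  assume "convergent f"
  then obtain l where "f \<longlonglongrightarrow> l" by (auto simp: convergent_def)
  from tendsto_diff[OF this assms] show "convergent g" by (auto simp: convergent_def)
next
  assume "convergent g"
  then obtain l where "g \<longlonglongrightarrow> l" by (auto simp: convergent_def)
  from tendsto_add[OF this assms] show "convergent f" by (auto simp: convergent_def)
qed

text \<open>\<open>odd_cf_Fn n 1\<close> is constantly 1, and increments over cells converge, so
  convergence spreads from endpoint to endpoint. Only then does \<open>lim\<close> in
  \<open>odd_cf_F\<close> denote an actual limit.\<close>

lemma odd_cf_Fn_convergent: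
  "cell k p r q s \<Longrightarrow> convergent (\<lambda>n. odd_cf_Fn n (p / r)) \<and> convergent (\<lambda>n. odd_cf_Fn n (q / s))"
proof (induction rule: cell.induct)
  case unit
  have "{\<xi> \<in> odd_cf_M n. \<xi> \<le> 1} = odd_cf_M n" for n by (auto simp: odd_cf_M_def)
  then have "odd_cf_Fn n 1 = 1" for n by (simp add: odd_cf_Fn_def card_odd_cf_M)
  then have "convergent (\<lambda>n. odd_cf_Fn n 1)" by (simp add: convergent_const)
  with convergent_from_increment[OF odd_cf_Fn_increment[OF cell.unit]] show ?case by simp
next
  case (two k p r q s)
  with convergent_from_increment[OF odd_cf_Fn_increment[OF cell.two]] show ?case by blast
next
  \<comment> \<open>Both ends are new here: the first is reached from p/r across the sibling cell of
    rule \<open>two\<close>, the second from the first across the cell itself.\<close>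
  case (three k p r q s)
  with convergent_from_increment[OF odd_cf_Fn_increment[OF cell.two]]
    convergent_from_increment[OF odd_cf_Fn_increment[OF cell.three]] show ?case by blast
next
  case (one k p r q s)
  with convergent_from_increment[OF odd_cf_Fn_increment[OF cell.one]] show ?case by blast
qed

lemma odd_cf_F_increment:
  assumes "cell k p r q s"
  shows "odd_cf_F (p / r) - odd_cf_F (q / s) = (p * s - q * r) * (1 / tau) ^ k"
proof -
  have "(\<lambda>n. odd_cf_Fn n (p / r)) \<longlonglongrightarrow> odd_cf_F (p / r)" "(\<lambda>n. odd_cf_Fn n (q / s)) \<longlonglongrightarrow> odd_cf_F (q / s)"
    using odd_cf_Fn_convergent[OF assms] by (simp_all add: odd_cf_F_def convergent_LIMSEQ_iff)
  from tendsto_diff[OF this] odd_cf_Fn_increment[OF assms] show ?thesis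
    by (rule LIMSEQ_unique)
qed

section \<open>Slopes over intervals that contain the point\<close>

definition in_hull :: "real \<Rightarrow> real \<Rightarrow> real \<Rightarrow> bool" where
  "in_hull x a b \<longleftrightarrow> a \<le> x \<and> x \<le> b \<or> b \<le> x \<and> x \<le> a"

definition slope :: "(real \<Rightarrow> real) \<Rightarrow> real \<Rightarrow> real \<Rightarrow> real" where
  "slope f a b = (f b - f a) / (b - a)"

lemma slope_commute: "slope f a b = slope f b a"
  unfolding slope_def by (metis minus_diff_eq minus_divide_divide)

lemma slope_uminus: "slope (\<lambda>x. - f x) a b = - slope f a b"
  by (simp add: slope_def diff_divide_distrib)

text \<open>The slope over [a, b] is a weighted mean of the slopes from x to the ends; an end equal
  to x has weight 0.\<close>

lemma slope_less_straddle:
  assumes "a \<le> x" "x \<le> b" "a < b"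
    and "a \<noteq> x \<Longrightarrow> slope f x a < c" "b \<noteq> x \<Longrightarrow> slope f x b < c"
  shows "slope f a b < c"
proof -
  have l: "a < x \<Longrightarrow> f x - f a < c * (x - a)"
    using assms(4) unfolding slope_commute[of f x a] by (simp add: slope_def pos_divide_less_eq)
  have r: "x < b \<Longrightarrow> f b - f x < c * (b - x)"
    using assms(5) by (simp add: slope_def pos_divide_less_eq)
  have "f b - f a < c * (b - a)"
  proof (cases "a = x \<or> b = x")
    case True
    then show ?thesis using l r assms by auto
  next
    case False
    then have "f b - f x + (f x - f a) < c * (b - x) + c * (x - a)"
      using l r assms by (intro add_strict_mono) auto
    then show ?thesis by (simp add: algebra_simps)
  qed
  then show ?thesis using assms(3) by (simp add: slope_def pos_divide_less_eq)
qed

lemma slope_less_in_hull: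
  assumes "in_hull x a b" "a \<noteq> b"
    and "a \<noteq> x \<Longrightarrow> slope f x a < c" "b \<noteq> x \<Longrightarrow> slope f x b < c"
  shows "slope f a b < c"
  using slope_less_straddle[of a x b f c] slope_less_straddle[of b x a f c] assms
  by (auto simp: in_hull_def slope_commute[of f b a])

lemma slope_greater_in_hull:
  assumes "in_hull x a b" "a \<noteq> b"
    and "a \<noteq> x \<Longrightarrow> c < slope f x a" "b \<noteq> x \<Longrightarrow> c < slope f x b"
  shows "c < slope f a b"
  using slope_less_in_hull[of x a b "\<lambda>x. - f x" "- c"] assms by (simp add: slope_uminus)

text \<open>The value \<open>f x\<close> cancels, so nothing needs to be known about it.\<close>

lemma straddle_tendsto:
  assumes D: "has_ereal_derivative f D x S"
    and ab: "\<And>n. a n \<in> S" "\<And>n. b n \<in> S" "\<And>n. in_hull x (a n) (b n)" "\<And>n. a n \<noteq> b n"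
    and lim: "(\<lambda>n. b n - a n) \<longlonglongrightarrow> 0"
  shows "(\<lambda>n. ereal (slope f (a n) (b n))) \<longlonglongrightarrow> D"
proof -
  \<comment> \<open>An end may coincide with x, about which the punctured filter says
    nothing.\<close>
  have ev: "\<forall>\<^sub>F n in sequentially. (a n \<noteq> x \<longrightarrow> P (a n)) \<and> (b n \<noteq> x \<longrightarrow> P (b n))"
    if "\<forall>\<^sub>F y in at x within S. P y" for P
  proof -
    from that obtain \<delta> where \<delta>: "\<delta> > 0" "\<And>y. y \<in> S \<Longrightarrow> y \<noteq> x \<Longrightarrow> dist y x < \<delta> \<Longrightarrow> P y"
      unfolding eventually_at by blast
    have "\<forall>\<^sub>F n in sequentially. \<bar>b n - a n\<bar> < \<delta>"
      using tendstoD[OF lim \<delta>(1)] by (simp add: dist_real_def)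
    then show ?thesis
    proof eventually_elim
      case (elim n)
      then have "dist (a n) x < \<delta>" "dist (b n) x < \<delta>"
        using ab(3)[of n] by (auto simp: dist_real_def in_hull_def)
      then show ?case using \<delta>(2) ab(1,2) by blast
    qed
  qed
  have D': "((\<lambda>y. ereal (slope f x y)) \<longlongrightarrow> D) (at x within S)"
    using D by (simp add: has_ereal_derivative_def slope_def)
  show ?thesis
  proof (rule order_tendstoI)
    fix c assume "c < D"
    then obtain c' :: real where c': "c < ereal c'" "ereal c' < D"
      using ereal_dense2 by blast
    from ev[OF order_tendstoD(1)[OF D' c'(2)]]
    show "\<forall>\<^sub>F n in sequentially. c < ereal (slope f (a n) (b n))"
    proof eventually_elim
      case (elim n)
      then have "c' < slope f (a n) (b n)"
        using slope_greater_in_hull[OF ab(3,4)] by simp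
      then show ?case using c'(1) by (meson ereal_less_eq(3) less_imp_le less_le_trans)
    qed
  next
    fix c assume "D < c"
    then obtain c' :: real where c': "ereal c' < c" "D < ereal c'"
      using ereal_dense2 by blast
    from ev[OF order_tendstoD(2)[OF D' c'(2)]]
    show "\<forall>\<^sub>F n in sequentially. ereal (slope f (a n) (b n)) < c"
    proof eventually_elim
      case (elim n)
      then have "slope f (a n) (b n) < c'"
        using slope_less_in_hull[OF ab(3,4)] by simp
      then show ?case using c'(1) by (meson ereal_less_eq(3) less_imp_le le_less_trans)
    qed
  qed
qed

section \<open>Nested cells around a point and the ratios of their denominators\<close>

lemma cell_child:
  assumes "cell k p r q s" "in_hull x (q / s) (p / r)"
  shows "\<exists>k' p' r' q' s'. cell k' p' r' q' s' \<and> in_hull x (q' / s') (p' / r') \<and>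
    r * s + 1 \<le> r' * s' \<and>
    (s' / r' = 2 + s / r \<or> s' / r' * (2 + s / r) = 1 + s / r \<or> s' / r' * (s / r) = 1 + s / r)"
proof -
  have b: "1 \<le> r" "1 \<le> s" using cell_bounds[OF assms(1)] by auto
  have sq: "1 \<le> r * r" "1 \<le> s * s" "1 \<le> r * s"
    using b mult_mono[of 1 r 1 r] mult_mono[of 1 s 1 s] mult_mono[of 1 r 1 s] by auto
  \<comment> \<open>Three consecutive hulls leading from p/r to q/s cover the hull of the ends,
    wherever the two cut points lie.\<close>
  have "in_hull x ((2 * p + q) / (2 * r + s)) (p / r) \<or>
      in_hull x ((p + q) / (r + s)) ((2 * p + q) / (2 * r + s)) \<or>
      in_hull x ((p + q) / (r + s)) (q / s)"
    using assms(2) unfolding in_hull_def by linarith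
  then show ?thesis
  proof (elim disjE)
    assume "in_hull x ((2 * p + q) / (2 * r + s)) (p / r)"
    moreover have "r * s + 1 \<le> r * (2 * r + s)" "(2 * r + s) / r = 2 + s / r"
      using b sq by (auto simp: algebra_simps add_divide_distrib)
    ultimately show ?thesis using cell.two[OF assms(1)] by blast
  next
    assume "in_hull x ((p + q) / (r + s)) ((2 * p + q) / (2 * r + s))"
    moreover have "r * s + 1 \<le> (2 * r + s) * (r + s)"
      using sq by (simp add: algebra_simps)
    moreover have "(r + s) / (2 * r + s) * (2 + s / r) = 1 + s / r"
    proof -
      have "2 + s / r = (2 * r + s) / r" "1 + s / r = (r + s) / r"
        using b by (simp_all add: add_divide_distrib)
      then show ?thesis using b by simp
    qed
    ultimately show ?thesis using cell.three[OF assms(1)] by blast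
  next
    assume "in_hull x ((p + q) / (r + s)) (q / s)"
    moreover have "r * s + 1 \<le> s * (r + s)" "(r + s) / s * (s / r) = 1 + s / r"
      using b sq by (auto simp: algebra_simps add_divide_distrib)
    ultimately show ?thesis using cell.one[OF assms(1)] by blast
  qed
qed

lemma cells_shrinking_to:
  assumes "x \<in> {0..1}"
  shows "\<exists>k p r q s. cell k p r q s \<and> in_hull x (q / s) (p / r) \<and> real n \<le> r * s"
proof (induction n)
  case 0
  have "in_hull x (0 / 1) (1 / 1)" using assms by (simp add: in_hull_def)
  then show ?case using cell.unit by force
next
  case (Suc n)
  then obtain k p r q s where c: "cell k p r q s" "in_hull x (q / s) (p / r)" "real n \<le> r * s"
    by blast
  from cell_child[OF c(1,2)] obtain k' p' r' q' s'
    where "cell k' p' r' q' s'" "in_hull x (q' / s') (p' / r')" "r * s + 1 \<le> r' * s'" by blast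
  moreover from this c(3) have "real (Suc n) \<le> r' * s'" by simp
  ultimately show ?case by blast
qed

text \<open>Mass divided by length; the determinant occurs in both and its sign cancels.\<close>

lemma cell_slope:
  assumes "cell k p r q s"
  shows "slope odd_cf_F (q / s) (p / r) = r * s * (1 / tau) ^ k"
  using cell_det[OF assms] cell_bounds[OF assms]
  by (auto simp: slope_def odd_cf_F_increment[OF assms] cell_endpoints(3)[OF assms])

lemma inverse_tendsto_zero_of_nat_le:
  fixes g :: "nat \<Rightarrow> real"
  assumes "\<And>n. real n \<le> g n"
  shows "(\<lambda>n. 1 / g n) \<longlonglongrightarrow> 0"
proof -
  have "filterlim g at_top sequentially"
    by (rule filterlim_at_top_mono[OF filterlim_real_sequentially]) (use assms in simp)
  then show ?thesis
    by (intro tendsto_divide_0[OF tendsto_const] filterlim_at_top_imp_at_infinity)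
qed

lemma cell_slope_tendsto:
  assumes D: "has_ereal_derivative odd_cf_F D x {0..1}"
    and cells: "\<And>n. cell (k n) (p n) (r n) (q n) (s n)"
    and x: "\<And>n. in_hull x (q n / s n) (p n / r n)" and large: "\<And>n. real n \<le> r n * s n"
  shows "(\<lambda>n. ereal (r n * s n * (1 / tau) ^ k n)) \<longlonglongrightarrow> D"
proof -
  have b: "r n * s n > 0" for n using cell_bounds[OF cells[of n]] by simp
  have diff: "p n / r n - q n / s n = (p n * s n - q n * r n) / (r n * s n)" for n
    by (rule cell_endpoints(3)[OF cells])
  have "\<bar>p n / r n - q n / s n\<bar> = 1 / (r n * s n)" for n
    using cell_det[OF cells[of n]] b[of n] unfolding diff by auto
  then have "(\<lambda>n. \<bar>p n / r n - q n / s n\<bar>) \<longlonglongrightarrow> 0"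
    using inverse_tendsto_zero_of_nat_le[of "\<lambda>n. r n * s n"] large by simp
  then have "(\<lambda>n. p n / r n - q n / s n) \<longlonglongrightarrow> 0" by (simp only: tendsto_rabs_zero_iff)
  moreover have "q n / s n \<noteq> p n / r n" for n
    using diff[of n] cell_det[OF cells[of n]] b[of n] by auto
  ultimately have "(\<lambda>n. ereal (slope odd_cf_F (q n / s n) (p n / r n))) \<longlonglongrightarrow> D"
    using cell_endpoints[OF cells] x by (intro straddle_tendsto[OF D]) auto
  then show ?thesis by (simp add: cell_slope[OF cells])
qed

text \<open>Cutting each cell at the image of \<open>2/3\<close> gives two intervals, one of which contains \<open>x\<close>; whichever
  it is, comparing its slope with that of the cell forces the ratio of the denominators.\<close>

lemma denominator_ratio_tendsto:
  assumes D: "has_ereal_derivative odd_cf_F (ereal d) x {0..1}" and "d \<noteq> 0"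
    and cells: "\<And>n. cell (k n) (p n) (r n) (q n) (s n)"
    and x: "\<And>n. in_hull x (q n / s n) (p n / r n)" and large: "\<And>n. real n \<le> r n * s n"
  shows "(\<lambda>n. s n / r n) \<longlonglongrightarrow> tau - 1"
proof -
  define t where "t n = s n / r n" for n
  define w where "w n = (1 / tau) ^ k n" for n
  define m where "m n = (2 * p n + q n) / (2 * r n + s n)" for n
  have b: "1 \<le> r n" "1 \<le> s n" for n using cell_bounds[OF cells[of n]] by auto
  have t: "t n > 0" for n using b[of n] by (simp add: t_def)
  have w: "w n > 0" for n using tau(1) by (simp add: w_def)
  have L0: "(\<lambda>n. r n * s n * w n) \<longlonglongrightarrow> d"
    using cell_slope_tendsto[OF D cells x large] by (simp add: w_def)
  \<comment> \<open>\<open>m n\<close> is the image of 2/3; the piece from it to p/r is the child of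
    rule \<open>two\<close>, the other piece is the union of the remaining two children.\<close>
  define inA where "inA n \<longleftrightarrow> in_hull x (m n) (p n / r n)" for n
  define a where "a n = (if inA n then m n else q n / s n)" for n
  define c where "c n = (if inA n then p n / r n else m n)" for n
  have cell2: "cell (k n + 2) (p n) (r n) (2 * p n + q n) (2 * r n + s n)" for n
    by (rule cell.two[OF cells])
  define e where "e n = p n * s n - q n * r n" for n
  have e: "e n = 1 \<or> e n = -1" for n using cell_det[OF cells[of n]] by (simp add: e_def)
  have dA: "p n / r n - m n = e n / (r n * (2 * r n + s n))" for n
    using cell_endpoints(3)[OF cell2[of n]] by (simp add: m_def e_def algebra_simps)
  have d0: "p n / r n - q n / s n = e n / (r n * s n)" for n
    using cell_endpoints(3)[OF cells[of n]] by (simp add: e_def)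
  have dB: "m n - q n / s n = 2 * e n / (s n * (2 * r n + s n))" for n
  proof -
    have "m n - q n / s n = e n / (r n * s n) - e n / (r n * (2 * r n + s n))"
      using dA[of n] d0[of n] by simp
    also have "\<dots> = 2 * e n / (s n * (2 * r n + s n))"
      using b[of n] by (simp add: divide_simps) (simp add: algebra_simps)
    finally show ?thesis .
  qed
  have FA: "odd_cf_F (p n / r n) - odd_cf_F (m n) = e n * (w n / tau ^ 2)" for n
  proof -
    have "p n * (2 * r n + s n) - (2 * p n + q n) * r n = e n"
      by (simp add: e_def algebra_simps)
    then show ?thesis
      using odd_cf_F_increment[OF cell2[of n]]
      by (simp add: m_def w_def power_add power_one_over power2_eq_square)
  qed
  have F0: "odd_cf_F (p n / r n) - odd_cf_F (q n / s n) = e n * w n" for n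
    using odd_cf_F_increment[OF cells[of n]] by (simp add: e_def w_def)
  have FB: "odd_cf_F (m n) - odd_cf_F (q n / s n) = e n * (w n * (1 - 1 / tau ^ 2))" for n
    using FA[of n] F0[of n] by (simp add: algebra_simps)
  have slope: "slope odd_cf_F (a n) (c n) = (if inA n then r n * (2 * r n + s n) * w n / tau ^ 2
      else s n * (2 * r n + s n) / 2 * w n * (1 - 1 / tau ^ 2))" for n
    using e[of n] b[of n] by (auto simp: slope_def a_def c_def FA FB dA dB)
  have hull: "in_hull x (a n) (c n)" for n
    using x[of n] by (auto simp: a_def c_def inA_def in_hull_def)
  have m01: "m n \<in> {0..1}" for n using cell_endpoints(2)[OF cell2[of n]] by (simp add: m_def)
  have sum0: "(\<lambda>n. c n - a n) \<longlonglongrightarrow> 0"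
  proof (rule tendsto_0_le)
    have "norm (c n - a n) \<le> norm (1 / (r n * s n)) * 2" for n
    proof -
      have "1 / (r n * (2 * r n + s n)) \<le> 2 / (r n * s n)"
        using b[of n] by (intro frac_le mult_left_mono mult_pos_pos) auto
      moreover have "2 / (s n * (2 * r n + s n)) \<le> 2 / (s n * r n)"
        using b[of n] by (intro divide_left_mono mult_left_mono mult_pos_pos) auto
      ultimately show ?thesis
        using e[of n] b[of n] unfolding a_def c_def
        by (auto simp: dA dB abs_divide abs_mult mult.commute)
    qed
    then show "\<forall>\<^sub>F n in sequentially. norm (c n - a n) \<le> norm (1 / (r n * s n)) * 2" by simp
    show "(\<lambda>n. 1 / (r n * s n)) \<longlonglongrightarrow> 0"
      by (rule inverse_tendsto_zero_of_nat_le[OF large])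
  qed
  have "a n \<noteq> c n" for n
  proof -
    have "p n / r n - m n \<noteq> 0" "m n - q n / s n \<noteq> 0"
      unfolding dA dB using e[of n] b[of n] by auto
    then show ?thesis by (auto simp: a_def c_def)
  qed
  then have "(\<lambda>n. ereal (slope odd_cf_F (a n) (c n))) \<longlonglongrightarrow> ereal d"
    using cell_endpoints[OF cells] m01 hull sum0
    by (intro straddle_tendsto[OF D]) (auto simp: a_def c_def)
  then have L1: "(\<lambda>n. slope odd_cf_F (a n) (c n)) \<longlonglongrightarrow> d" by simp
  define \<rho> where "\<rho> n = slope odd_cf_F (a n) (c n) / (r n * s n * w n)" for n
  have \<rho>: "\<rho> \<longlonglongrightarrow> 1"
    using tendsto_divide[OF L1 L0 \<open>d \<noteq> 0\<close>] \<open>d \<noteq> 0\<close> by (simp add: \<rho>_def[abs_def])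
  \<comment> \<open>The cubic for \<open>tau\<close>, rearranged; through it both pieces lead to the
    same limit \<open>tau - 1\<close>.\<close>
  have tau_id: "(tau ^ 2 - 1) * (tau - 1) = 2"
    using tau(2) by (simp add: algebra_simps power2_eq_square power3_eq_cube)
  have tau2: "tau ^ 2 > 1" using tau(1) by simp
  then have tau_ne: "tau ^ 2 \<noteq> 1" by linarith
  have tau0: "tau \<noteq> 0" using tau(1) by simp
  have \<rho>_val: "\<rho> n = (if inA n then (2 + t n) / t n / tau ^ 2 else (2 + t n) / 2 * (1 - 1 / tau ^ 2))" for n
    using b[of n] w[of n] unfolding \<rho>_def slope t_def
    by (simp add: divide_simps)
  \<comment> \<open>\<open>g1\<close> and \<open>g2\<close> recover the denominator ratio from the
    slope quotient \<open>\<rho> n\<close> on the two pieces. Both take the value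
    \<open>tau - 1\<close> at 1, so it does not matter how the pieces alternate.\<close>
  define g1 where "g1 y = 2 / (tau ^ 2 * y - 1)" for y
  define g2 where "g2 y = 2 * y / (1 - 1 / tau ^ 2) - 2" for y
  have t_val: "t n = (if inA n then g1 (\<rho> n) else g2 (\<rho> n))" for n
  proof (cases "inA n")
    case True
    then have "tau ^ 2 * \<rho> n - 1 = 2 / t n" using t[of n] tau(1) by (simp add: \<rho>_val field_simps)
    then show ?thesis using True by (simp add: g1_def)
  next
    case False
    have "1 - 1 / tau ^ 2 \<noteq> 0" using tau2 by simp
    then show ?thesis using False by (simp add: \<rho>_val g2_def)
  qed
  have "(\<lambda>n. g1 (\<rho> n)) \<longlonglongrightarrow> 2 / (tau ^ 2 * 1 - 1)"
    unfolding g1_def using tau2 by (intro tendsto_intros \<rho>) auto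
  also have "2 / (tau ^ 2 * 1 - 1) = tau - 1" using tau_id tau2 by (simp add: field_simps)
  finally have g1: "(\<lambda>n. g1 (\<rho> n)) \<longlonglongrightarrow> tau - 1" .
  have "(\<lambda>n. g2 (\<rho> n)) \<longlonglongrightarrow> 2 * 1 / (1 - 1 / tau ^ 2) - 2"
    unfolding g2_def using tau_ne tau0 by (intro tendsto_intros \<rho>) auto
  also have "2 * 1 / (1 - 1 / tau ^ 2) - 2 = 2 / (tau ^ 2 - 1)" using tau_ne tau0 by (simp add: field_simps)
  also have "2 / (tau ^ 2 - 1) = tau - 1" using tau_id tau2 by (simp add: field_simps)
  finally have g2: "(\<lambda>n. g2 (\<rho> n)) \<longlonglongrightarrow> tau - 1" .
  have "(\<lambda>n. if inA n then g1 (\<rho> n) else g2 (\<rho> n)) \<longlonglongrightarrow> tau - 1"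
    by (intro filterlim_If filterlim_mono[OF g1] filterlim_mono[OF g2]) (auto intro: inf_le1 le_infI1)
  then show ?thesis by (simp only: t_val[symmetric] t_def)
qed

theorem theorem3:
  fixes x :: real and D :: ereal
  assumes "x \<in> {0..1}"
    and "has_ereal_derivative odd_cf_F D x {0..1}"
  shows "D = 0 \<or> D = \<infinity>"
proof (rule ccontr)
  assume contr: "\<not> (D = 0 \<or> D = \<infinity>)"
  have "\<exists>k p r q s. \<forall>n. cell (k n) (p n) (r n) (q n) (s n) \<and>
      in_hull x (q n / s n) (p n / r n) \<and> real n \<le> r n * s n"
    using cells_shrinking_to[OF assms(1)] by metis
  then obtain k p r q s where c: "\<And>n. cell (k n) (p n) (r n) (q n) (s n)"
      "\<And>n. in_hull x (q n / s n) (p n / r n)" "\<And>n. real n \<le> r n * s n" by blast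
  \<comment> \<open>Cell slopes are nonnegative, hence so is their limit, which rules out a negative
    or minus infinite derivative.\<close>
  have "0 \<le> r n * s n * (1 / tau) ^ k n" for n
    using cell_bounds[OF c(1)[of n]] tau(1) by simp
  then have "0 \<le> D"
    using cell_slope_tendsto[OF assms(2) c] by (intro LIMSEQ_le_const) (auto simp: zero_ereal_def)
  with contr obtain d where d: "D = ereal d" "d \<noteq> 0" by (cases D) auto
  note lim = denominator_ratio_tendsto[OF assms(2)[unfolded d(1)] d(2)]
  have "\<forall>n. \<exists>k' p' r' q' s'. cell k' p' r' q' s' \<and> in_hull x (q' / s') (p' / r') \<and>
    r n * s n + 1 \<le> r' * s' \<and>
    (s' / r' = 2 + s n / r n \<or> s' / r' * (2 + s n / r n) = 1 + s n / r n \<or>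
     s' / r' * (s n / r n) = 1 + s n / r n)"
    using cell_child[OF c(1,2)] by blast
  then obtain k' p' r' q' s' where c': "\<And>n. cell (k' n) (p' n) (r' n) (q' n) (s' n)"
      "\<And>n. in_hull x (q' n / s' n) (p' n / r' n)" "\<And>n. r n * s n + 1 \<le> r' n * s' n"
      "\<And>n. s' n / r' n = 2 + s n / r n \<or> s' n / r' n * (2 + s n / r n) = 1 + s n / r n \<or>
     s' n / r' n * (s n / r n) = 1 + s n / r n"
    by metis
  define t t' where "t n = s n / r n" and "t' n = s' n / r' n" for n
  have t: "t \<longlonglongrightarrow> tau - 1" using lim[OF c] by (simp add: t_def[abs_def])
  have "real n \<le> r' n * s' n" for n using c(3)[of n] c'(3)[of n] by linarith
  from lim[OF c'(1,2) this] have t': "t' \<longlonglongrightarrow> tau - 1" by (simp add: t'_def[abs_def])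
  \<comment> \<open>One factor for each kind of child. The product vanishes at every
    \<open>n\<close> whichever child is taken, so no subsequence of constant kind has to be
    chosen.\<close>
  let ?h = "\<lambda>t t'. (t' - 2 - t) * (t' * (2 + t) - 1 - t) * (t' * t - 1 - t :: real)"
  have "(\<lambda>n. ?h (t n) (t' n)) \<longlonglongrightarrow> ?h (tau - 1) (tau - 1)"
    by (intro tendsto_intros t t')
  moreover have "?h (t n) (t' n) = 0" for n using c'(4)[of n] by (auto simp: t_def t'_def)
  ultimately have "?h (tau - 1) (tau - 1) = 0" using LIMSEQ_unique[OF tendsto_const] by fastforce
  \<comment> \<open>The first factor is -2 when both arguments agree; the other two give the
    quadratics below.\<close>
  then have "(tau - 1) * (2 + (tau - 1)) - 1 - (tau - 1) = 0 \<or> (tau - 1) * (tau - 1) - 1 - (tau - 1) = 0"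
    by (simp only: mult_eq_0_iff) auto
  then have "tau ^ 2 = tau + 1 \<or> tau ^ 2 = 3 * tau - 1"
    by (auto simp: power2_eq_square algebra_simps)
  then show False
  proof
    assume *: "tau ^ 2 = tau + 1"
    have "tau ^ 3 = tau * tau ^ 2" by (simp add: power2_eq_square power3_eq_cube)
    also have "\<dots> = tau ^ 2 + tau" unfolding * by (simp add: algebra_simps flip: power2_eq_square) (simp add: *)
    finally show False using tau(2) by simp
  next
    assume *: "tau ^ 2 = 3 * tau - 1"
    have "tau ^ 3 = tau * tau ^ 2" by (simp add: power2_eq_square power3_eq_cube)
    \<comment> \<open>Together with the cubic this yields 4 \<open>tau\<close> = 3, against
      \<open>tau > 1\<close>.\<close>
    also have "\<dots> = 3 * tau ^ 2 - tau" by (subst *) (simp add: algebra_simps power2_eq_square)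
    finally show False using tau * by simp
  qed
qed

end
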